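(* Let $n>p\ge3$ be integers, $\alpha>0$, and equip $\mathrm{St}_{p,n}=\{Y\in\mathbb{R}^{n\times p}:Y^{\mathsf T}Y=I_p\}$ with the Riemannian metric $$\langle\xi,\eta\rangle=\operatorname{Tr}(\xi^{\mathsf T}\eta)+(\alpha-1)\operatorname{Tr}(\xi^{\mathsf T}YY^{\mathsf T}\eta),\qquad \xi,\eta\in T_Y\mathrm{St}_{p,n}.$$ Then the sectional curvature range of $\mathrm{St}_{p,n}$ contains the interval $I=I(n,p,\alpha)$ defined as follows (with the function $\mathfrak l$ defined in the context). (a) If $(n,p)=(4,3)$: $I=[0,\frac{1}{8\alpha}]$ for $0<\alpha\le\frac16$; $I=[0,\frac{1}{1+2\alpha}]$ for $\frac16<\alpha\le\frac12$; $I=[\mathfrak l(\alpha),\frac{1}{1+2\alpha}]$ for $\frac12<\alpha\le\frac{7}{10}$; $I=[\frac{2-3\alpha}{2},\frac{1}{1+2\alpha}]$ for $\frac{7}{10}<\alpha\le\frac{\sqrt{17}-1}{4}$; $I=[\frac{2-3\alpha}{2},\frac{\alpha}{2}]$ for $\alpha>\frac{\sqrt{17}-1}{4}$. (b) If $p=3$ and $n\ge5$: $I=[0,\frac{1}{8\alpha}]$ for $0<\alpha\le\frac{4-\sqrt{13}}{6}$; $I=[0,\frac{4-3\alpha}{2}]$ for $\frac{4-\sqrt{13}}{6}<\alpha\le\frac12$; $I=[\mathfrak l(\alpha),\frac{4-3\alpha}{2}]$ for $\frac12<\alpha\le\frac23$; $I=[\mathfrak l(\alpha),1]$ for $\frac23<\alpha\le\frac{7}{10}$;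 $I=[\frac{2-3\alpha}{2},1]$ for $\frac{7}{10}<\alpha\le2$; $I=[\frac{2-3\alpha}{2},\frac{\alpha}{2}]$ for $\alpha>2$. (c) If $n-2\ge p\ge4$: $I=[0,\frac{1}{4\alpha}]$ for $0<\alpha\le\frac{4-\sqrt{10}}{6}$; $I=[0,\frac{4-3\alpha}{2}]$ for $\frac{4-\sqrt{10}}{6}<\alpha\le\frac12$; $I=[\mathfrak l(\alpha),\frac{4-3\alpha}{2}]$ for $\frac12<\alpha\le\frac23$; $I=[\mathfrak l(\alpha),1]$ for $\frac23<\alpha\le\frac{7}{10}$; $I=[\frac{2-3\alpha}{2},1]$ for $\frac{7}{10}<\alpha\le2$; $I=[\frac{2-3\alpha}{2},\frac{\alpha}{2}]$ for $\alpha>2$. (d) If $p=n-1$ and $n\ge5$: $I=[0,\frac{1}{4\alpha}]$ for $0<\alpha\le\frac12$; $I=[\mathfrak l(\alpha),\frac{1}{1+2\alpha}]$ for $\frac12<\alpha\le\frac{7}{10}$; $I=[\frac{2-3\alpha}{2},\frac{1}{1+2\alpha}]$ for $\frac{7}{10}<\alpha\le\frac{\sqrt{17}-1}{4}$; $I=[\frac{2-3\alpha}{2},\frac{\alpha}{2}]$ for $\alpha>\frac{\sqrt{17}-1}{4}$.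
   Context: The sectional curvature range is the set of all values of the sectional curvature over all two-dimensional subspaces (sections) of tangent spaces, with the usual sign convention in which round spheres have positive sectional curvature. For $\alpha>0$, $\gamma>0$ put $$\mathfrak c(\gamma)=\frac{\alpha/2+\alpha(4\alpha-3)\gamma+(2-3\alpha)\gamma^2/2}{(2\alpha+\gamma)^2},\qquad \gamma_{\min}(\alpha)=\frac{1+6\alpha-8\alpha^2}{7-10\alpha}.$$ For $\frac12<\alpha<\frac{7}{10}$ define $\mathfrak l(\alpha)=\mathfrak c(\gamma_{\min}(\alpha))$, and set $\mathfrak l(\frac{7}{10})=-\frac{1}{20}$ (the value making $\mathfrak l$ continuous at $\frac7{10}$). *)

theory Defs
  imports "HOL-Analysis.Analysis"
begin

section \<open>Smooth maps between Euclidean spaces\<close>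

primrec times_differentiable ::
    "nat \<Rightarrow> ('a::euclidean_space \<Rightarrow> 'b::euclidean_space) \<Rightarrow> bool" where
  "times_differentiable 0 f \<longleftrightarrow> continuous_on UNIV f"
| "times_differentiable (Suc k) f \<longleftrightarrow>
     (\<forall>x. f differentiable at x) \<and>
     (\<forall>v. times_differentiable k (\<lambda>x. frechet_derivative f (at x) v))"

definition smooth :: "('a::euclidean_space \<Rightarrow> 'b::euclidean_space) \<Rightarrow> bool" where
  "smooth f \<longleftrightarrow> (\<forall>k. times_differentiable k f)"


section \<open>Riemannian geometry of embedded submanifolds\<close>

text \<open>
  The notions below are meant for a closed embedded submanifold \<open>M\<close> of a Euclidean space, with a
  Riemannian metric \<open>g p u v\<close> (\<open>p\<close> in \<open>M\<close>, \<open>u\<close> and \<open>v\<close> tangent at \<open>p\<close>) given by a formula that is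
  smooth on the ambient space. Every smooth vector field on such an \<open>M\<close> is the restriction of a
  smooth map on the ambient space, so vector fields are represented by ambient smooth maps that
  are tangent to \<open>M\<close> along \<open>M\<close>. All identities between fields are required on \<open>M\<close> only;
  there, derivatives in tangent directions do not depend on the chosen extensions.
\<close>

text \<open>On a submanifold, every tangent vector is the velocity of a smooth curve and velocities of
  curves that are merely differentiable at \<open>0\<close> give nothing more.\<close>

definition tangent_space :: "'a::euclidean_space set \<Rightarrow> 'a \<Rightarrow> 'a set" where
  "tangent_space M p =
     {v. \<exists>c::real \<Rightarrow> 'a. (\<forall>t. c t \<in> M) \<and> c 0 = p \<and> (c has_vector_derivative v) (at 0)}"

definition vector_fields :: "'a::euclidean_space set \<Rightarrow> ('a \<Rightarrow> 'a) set" where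
  "vector_fields M = {X. smooth X \<and> (\<forall>p\<in>M. X p \<in> tangent_space M p)}"

definition deriv_along ::
    "('a::euclidean_space \<Rightarrow> 'a) \<Rightarrow> ('a \<Rightarrow> 'b::euclidean_space) \<Rightarrow> 'a \<Rightarrow> 'b" where
  "deriv_along X f p = frechet_derivative f (at p) (X p)"

definition lie_bracket ::
    "('a::euclidean_space \<Rightarrow> 'a) \<Rightarrow> ('a \<Rightarrow> 'a) \<Rightarrow> 'a \<Rightarrow> 'a" where
  "lie_bracket X Z p = deriv_along X Z p - deriv_along Z X p"

locale affine_connection =
  fixes M :: "'a::euclidean_space set"
    and D :: "('a \<Rightarrow> 'a) \<Rightarrow> ('a \<Rightarrow> 'a) \<Rightarrow> 'a \<Rightarrow> 'a"
  assumes vector_field: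
      "\<lbrakk>X \<in> vector_fields M; Z \<in> vector_fields M\<rbrakk> \<Longrightarrow> D X Z \<in> vector_fields M"
    and function_linear:
      "\<lbrakk>X \<in> vector_fields M; X' \<in> vector_fields M; Z \<in> vector_fields M;
        smooth f; smooth h; p \<in> M\<rbrakk>
       \<Longrightarrow> D (\<lambda>q. f q *\<^sub>R X q + h q *\<^sub>R X' q) Z p = f p *\<^sub>R D X Z p + h p *\<^sub>R D X' Z p"
    and additive:
      "\<lbrakk>X \<in> vector_fields M; Z \<in> vector_fields M; Z' \<in> vector_fields M; p \<in> M\<rbrakk>
       \<Longrightarrow> D X (\<lambda>q. Z q + Z' q) p = D X Z p + D X Z' p"
    and leibniz:
      "\<lbrakk>X \<in> vector_fields M; Z \<in> vector_fields M; smooth f; p \<in> M\<rbrakk>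
       \<Longrightarrow> D X (\<lambda>q. f q *\<^sub>R Z q) p = deriv_along X f p *\<^sub>R Z p + f p *\<^sub>R D X Z p"

locale levi_civita = affine_connection M D
  for M :: "'a::euclidean_space set"
    and D :: "('a \<Rightarrow> 'a) \<Rightarrow> ('a \<Rightarrow> 'a) \<Rightarrow> 'a \<Rightarrow> 'a" +
  fixes g :: "'a \<Rightarrow> 'a \<Rightarrow> 'a \<Rightarrow> real"
  assumes torsion_free:
      "\<lbrakk>X \<in> vector_fields M; Z \<in> vector_fields M; p \<in> M\<rbrakk>
       \<Longrightarrow> D X Z p - D Z X p = lie_bracket X Z p"
    and metric_compatible:
      "\<lbrakk>X \<in> vector_fields M; Z \<in> vector_fields M; W \<in> vector_fields M; p \<in> M\<rbrakk>
       \<Longrightarrow> deriv_along X (\<lambda>q. g q (Z q) (W q)) p = g p (D X Z p) (W p) + g p (Z p) (D X W p)"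

definition curvature ::
    "(('a::euclidean_space \<Rightarrow> 'a) \<Rightarrow> ('a \<Rightarrow> 'a) \<Rightarrow> 'a \<Rightarrow> 'a)
     \<Rightarrow> ('a \<Rightarrow> 'a) \<Rightarrow> ('a \<Rightarrow> 'a) \<Rightarrow> ('a \<Rightarrow> 'a) \<Rightarrow> 'a \<Rightarrow> 'a" where
  "curvature D X Y Z p = D X (D Y Z) p - D Y (D X Z) p - D (lie_bracket X Y) Z p"

text \<open>The Levi-Civita connection is unique on \<open>M\<close> and curvature is tensorial, so the value \<open>k\<close>
  depends neither on \<open>D\<close> nor on the fields \<open>X\<close>, \<open>Y\<close> extending a basis of the section \<open>S\<close>.\<close>

definition has_sectional_curvature ::
    "'a::euclidean_space set \<Rightarrow> ('a \<Rightarrow> 'a \<Rightarrow> 'a \<Rightarrow> real) \<Rightarrow> 'a \<Rightarrow> 'a set \<Rightarrow> real \<Rightarrow> bool" where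
  "has_sectional_curvature M g p S k \<longleftrightarrow>
     (\<exists>D X Y. levi_civita M D g \<and> X \<in> vector_fields M \<and> Y \<in> vector_fields M \<and>
        span {X p, Y p} = S \<and>
        k = g p (curvature D X Y Y p) (X p) /
            (g p (X p) (X p) * g p (Y p) (Y p) - (g p (X p) (Y p))\<^sup>2))"

definition sectional_curvature_range ::
    "'a::euclidean_space set \<Rightarrow> ('a \<Rightarrow> 'a \<Rightarrow> 'a \<Rightarrow> real) \<Rightarrow> real set" where
  "sectional_curvature_range M g =
     {k. \<exists>p\<in>M. \<exists>S. subspace S \<and> S \<subseteq> tangent_space M p \<and> dim S = 2 \<and>
          has_sectional_curvature M g p S k}"


section \<open>The Stiefel manifold\<close>

text \<open>Matrices with \<open>n\<close> rows and \<open>p\<close> columns have type \<open>real ^ 'p ^ 'n\<close>.\<close>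

definition Stiefel :: "(real ^ 'p ^ 'n) set" where
  "Stiefel = {Y. transpose Y ** Y = mat 1}"

definition stiefel_metric ::
    "real \<Rightarrow> real ^ 'p ^ 'n \<Rightarrow> real ^ 'p ^ 'n \<Rightarrow> real ^ 'p ^ 'n \<Rightarrow> real" where
  "stiefel_metric \<alpha> Y \<xi> \<eta> =
     trace (transpose \<xi> ** \<eta>) + (\<alpha> - 1) * trace (transpose \<xi> ** Y ** transpose Y ** \<eta>)"


section \<open>The curvature interval\<close>

definition cfun :: "real \<Rightarrow> real \<Rightarrow> real" where
  "cfun \<alpha> \<gamma> =
     (\<alpha> / 2 + \<alpha> * (4 * \<alpha> - 3) * \<gamma> + (2 - 3 * \<alpha>) * \<gamma>\<^sup>2 / 2) / (2 * \<alpha> + \<gamma>)\<^sup>2"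

definition gamma_min :: "real \<Rightarrow> real" where
  "gamma_min \<alpha> = (1 + 6 * \<alpha> - 8 * \<alpha>\<^sup>2) / (7 - 10 * \<alpha>)"

text \<open>Only used for \<open>1/2 < \<alpha> \<le> 7/10\<close>.\<close>

definition lfun :: "real \<Rightarrow> real" where
  "lfun \<alpha> = (if \<alpha> = 7 / 10 then - (1 / 20) else cfun \<alpha> (gamma_min \<alpha>))"

text \<open>Only used for \<open>n > p \<ge> 3\<close> and \<open>\<alpha> > 0\<close>; under these assumptions the final branch is the case
  \<open>p = n - 1\<close>, \<open>n \<ge> 5\<close>.\<close>

definition curvature_interval :: "nat \<Rightarrow> nat \<Rightarrow> real \<Rightarrow> real set" where
  "curvature_interval n p \<alpha> =
    (if n = 4 \<and> p = 3 then
       (if \<alpha> \<le> 1 / 6 then {0 .. 1 / (8 * \<alpha>)}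
        else if \<alpha> \<le> 1 / 2 then {0 .. 1 / (1 + 2 * \<alpha>)}
        else if \<alpha> \<le> 7 / 10 then {lfun \<alpha> .. 1 / (1 + 2 * \<alpha>)}
        else if \<alpha> \<le> (sqrt 17 - 1) / 4 then {(2 - 3 * \<alpha>) / 2 .. 1 / (1 + 2 * \<alpha>)}
        else {(2 - 3 * \<alpha>) / 2 .. \<alpha> / 2})
     else if p = 3 then
       (if \<alpha> \<le> (4 - sqrt 13) / 6 then {0 .. 1 / (8 * \<alpha>)}
        else if \<alpha> \<le> 1 / 2 then {0 .. (4 - 3 * \<alpha>) / 2}
        else if \<alpha> \<le> 2 / 3 then {lfun \<alpha> .. (4 - 3 * \<alpha>) / 2}
        else if \<alpha> \<le> 7 / 10 then {lfun \<alpha> .. 1}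
        else if \<alpha> \<le> 2 then {(2 - 3 * \<alpha>) / 2 .. 1}
        else {(2 - 3 * \<alpha>) / 2 .. \<alpha> / 2})
     else if p + 2 \<le> n then
       (if \<alpha> \<le> (4 - sqrt 10) / 6 then {0 .. 1 / (4 * \<alpha>)}
        else if \<alpha> \<le> 1 / 2 then {0 .. (4 - 3 * \<alpha>) / 2}
        else if \<alpha> \<le> 2 / 3 then {lfun \<alpha> .. (4 - 3 * \<alpha>) / 2}
        else if \<alpha> \<le> 7 / 10 then {lfun \<alpha> .. 1}
        else if \<alpha> \<le> 2 then {(2 - 3 * \<alpha>) / 2 .. 1}
        else {(2 - 3 * \<alpha>) / 2 .. \<alpha> / 2})
     else
       (if \<alpha> \<le> 1 / 2 then {0 .. 1 / (4 * \<alpha>)}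
        else if \<alpha> \<le> 7 / 10 then {lfun \<alpha> .. 1 / (1 + 2 * \<alpha>)}
        else if \<alpha> \<le> (sqrt 17 - 1) / 4 then {(2 - 3 * \<alpha>) / 2 .. 1 / (1 + 2 * \<alpha>)}
        else {(2 - 3 * \<alpha>) / 2 .. \<alpha> / 2}))"

end

(*
  The formula for the metric makes sense on the whole space of n x p matrices, and its Levi-Civita
  connection is the ambient derivative plus a Christoffel term that is polynomial in the base point.
  Every tangent vector at q is a ** q with a skew-symmetric, so curvatures can be computed with the
  linear fields q |-> a ** q, for which all second derivatives cancel. At one base point the linearly
  independent pairs of tangent vectors form a connected set, because the tangent space has dimension
  at least 5; hence the curvature range contains every interval whose endpoints are attained there,
  and each endpoint of the statement is attained by an explicit pair of combinations of matrix units.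
*)

theory Submission
  imports Defs
begin

section \<open>Calculus of smooth maps\<close>

text \<open>A connection must return fields that are smooth on all n x p matrices, including those
  with singular \<open>transpose q ** q\<close>. So no inverse of that matrix may enter, and the
  connection is an ambient formula whose tangency and metric compatibility hold only along the
  manifold. The breakpoints in \<alpha> are the points where two attained values meet: 1/(8
  \<alpha>) and 1/(1 + 2 \<alpha>) at 1/6, 1/(4 \<alpha>) and 1/(1 + 2 \<alpha>) at 1/2, 1/(1 + 2
  \<alpha>) and \<alpha>/2 at (sqrt 17 - 1)/4, (4 - 3 \<alpha>)/2 and 1/(8 \<alpha>) or 1/(4
  \<alpha>) at (4 - sqrt 13)/6 or (4 - sqrt 10)/6, (4 - 3 \<alpha>)/2 and 1 at 2/3, 1 and \<alpha>/2
  at 2. For 1/2 < \<alpha> < 7/10, \<open>lfun \<alpha>\<close> is the minimum of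
  \<open>cfun \<alpha> \<gamma>\<close> over \<gamma> \<ge> 0. It tends to 0 as \<alpha> decreases
  to 1/2, and to (2 - 3 \<alpha>)/2 as \<alpha> increases to 7/10, where the minimiser escapes to
  infinity.\<close>

lemma times_differentiable_Suc_imp:
  "times_differentiable (Suc k) f \<Longrightarrow> times_differentiable k f"
proof (induction k arbitrary: f)
  case 0
  then show ?case
    by (auto intro!: differentiable_imp_continuous_on differentiable_at_imp_differentiable_on)
qed auto

lemma times_differentiable_const: "times_differentiable k (\<lambda>_. c)"
  by (induction k arbitrary: c) auto

lemma times_differentiable_linear:
  assumes "bounded_linear f"
  shows "times_differentiable k f"
proof (cases k)
  case 0
  then show ?thesis using assms by (simp add: linear_continuous_on)
next
  case (Suc m)
  have "frechet_derivative f (at x) = f" for x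
    using frechet_derivative_at[OF bounded_linear_imp_has_derivative[OF assms]] by simp
  then show ?thesis
    using assms Suc bounded_linear_imp_has_derivative[OF assms]
    by (auto simp: times_differentiable_const differentiable_def)
qed

lemma times_differentiable_add:
  "times_differentiable k f \<Longrightarrow> times_differentiable k g \<Longrightarrow> times_differentiable k (\<lambda>x. f x + g x)"
proof (induction k arbitrary: f g)
  case 0
  then show ?case by (auto intro: continuous_intros)
next
  case (Suc k)
  have d: "((\<lambda>x. f x + g x) has_derivative
      (\<lambda>v. frechet_derivative f (at x) v + frechet_derivative g (at x) v)) (at x)" for x
    using Suc.prems by (auto intro!: derivative_intros simp flip: frechet_derivative_works)
  have "frechet_derivative (\<lambda>x. f x + g x) (at x)
      = (\<lambda>v. frechet_derivative f (at x) v + frechet_derivative g (at x) v)" for x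
    using frechet_derivative_at[OF d] by simp
  moreover have "(\<lambda>x. f x + g x) differentiable at x" for x
    using d unfolding differentiable_def by blast
  ultimately show ?case using Suc by auto
qed

text \<open>By the product rule a directional derivative of h (f x) (g x) is a sum of two terms of
  the same shape, so induction with f and g arbitrary closes. Scalar multiples, matrix products and
  composition with linear maps are all instances.\<close>

lemma times_differentiable_bilinear:
  assumes h: "bounded_bilinear h"
  shows "times_differentiable k f \<Longrightarrow> times_differentiable k g
    \<Longrightarrow> times_differentiable k (\<lambda>x. h (f x) (g x))"
proof (induction k arbitrary: f g)
  case 0
  then show ?case by (auto intro: bounded_bilinear.continuous_on[OF h])
next
  case (Suc k)
  have d: "((\<lambda>x. h (f x) (g x)) has_derivative
      (\<lambda>v. h (f x) (frechet_derivative g (at x) v) + h (frechet_derivative f (at x) v) (g x))) (at x)"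
    for x
    using Suc.prems
    by (auto intro!: bounded_bilinear.FDERIV[OF h] simp flip: frechet_derivative_works)
  have "frechet_derivative (\<lambda>x. h (f x) (g x)) (at x)
     = (\<lambda>v. h (f x) (frechet_derivative g (at x) v) + h (frechet_derivative f (at x) v) (g x))" for x
    using frechet_derivative_at[OF d] by simp
  moreover have "(\<lambda>x. h (f x) (g x)) differentiable at x" for x
    using d unfolding differentiable_def by blast
  moreover have "times_differentiable k f" "times_differentiable k g"
    using Suc.prems times_differentiable_Suc_imp by blast+
  ultimately show ?case
    using Suc by (auto intro!: times_differentiable_add)
qed

lemma smooth_const: "smooth (\<lambda>_. c)"
  by (simp add: smooth_def times_differentiable_const)

lemma smooth_linear: "bounded_linear f \<Longrightarrow> smooth f"
  by (simp add: smooth_def times_differentiable_linear)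

lemma smooth_bilinear:
  "bounded_bilinear h \<Longrightarrow> smooth f \<Longrightarrow> smooth g \<Longrightarrow> smooth (\<lambda>x. h (f x) (g x))"
  by (simp add: smooth_def times_differentiable_bilinear)

lemma smooth_add: "smooth f \<Longrightarrow> smooth g \<Longrightarrow> smooth (\<lambda>x. f x + g x)"
  by (simp add: smooth_def times_differentiable_add)

lemma smooth_scaleR: "smooth f \<Longrightarrow> smooth g \<Longrightarrow> smooth (\<lambda>x. f x *\<^sub>R g x)"
  by (rule smooth_bilinear[OF bounded_bilinear_scaleR])

lemma smooth_diff:
  assumes "smooth f" "smooth g" shows "smooth (\<lambda>x. f x - g x)"
  using smooth_add[OF assms(1) smooth_scaleR[OF smooth_const[of "-1"] assms(2)]] by simp

lemma smooth_linear_compose: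
  assumes h: "bounded_linear h" and "smooth f"
  shows "smooth (\<lambda>x. h (f x))"
proof -
  \<comment> \<open>Composition with h becomes a bilinear expression by adding a scalar argument,
    later fixed to 1.\<close>
  have "bounded_bilinear (\<lambda>(c::real) y. c *\<^sub>R h y)"
    using bounded_bilinear.comp[OF bounded_bilinear_scaleR bounded_linear_ident h] by simp
  from smooth_bilinear[OF this smooth_const[of 1] \<open>smooth f\<close>] show ?thesis by simp
qed

lemma smooth_sum: "(\<And>i. i \<in> I \<Longrightarrow> smooth (f i)) \<Longrightarrow> smooth (\<lambda>x. \<Sum>i\<in>I. f i x)"
  by (induction I rule: infinite_finite_induct) (auto intro: smooth_const smooth_add)

lemma smooth_has_derivative:
  "smooth f \<Longrightarrow> (f has_derivative frechet_derivative f (at x)) (at x)"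
  by (metis frechet_derivative_works smooth_def times_differentiable.simps(2))

lemma smooth_frechet_derivative: "smooth f \<Longrightarrow> smooth (\<lambda>x. frechet_derivative f (at x) v)"
  unfolding smooth_def by (metis times_differentiable.simps(2))

text \<open>Smoothness is defined through derivatives in fixed directions, whereas here the
  direction varies with x. Expanding X x in the basis reduces this to fixed directions with smooth
  coefficients.\<close>

lemma smooth_deriv_along:
  assumes "smooth X" "smooth f"
  shows "smooth (\<lambda>x. frechet_derivative f (at x) (X x))"
proof -
  have "frechet_derivative f (at x) (X x)
      = (\<Sum>b\<in>Basis. (X x \<bullet> b) *\<^sub>R frechet_derivative f (at x) b)" for x
  proof -
    interpret linear "frechet_derivative f (at x)"
      using has_derivative_linear[OF smooth_has_derivative[OF assms(2)]] .
    show ?thesis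
      by (subst euclidean_representation[symmetric]) (simp add: sum scaleR)
  qed
  then show ?thesis
    using assms
    by (auto intro!: smooth_sum smooth_scaleR smooth_frechet_derivative
        smooth_linear_compose[OF bounded_linear_inner_left])
qed

section \<open>Matrix products\<close>

lemma bounded_bilinear_matrix_mult:
  "bounded_bilinear ((**) :: real ^ 'b::finite ^ 'a::finite \<Rightarrow> real ^ 'c::finite ^ 'b \<Rightarrow> real ^ 'c ^ 'a)"
proof -
  have "bilinear ((**) :: real ^ 'b ^ 'a \<Rightarrow> real ^ 'c ^ 'b \<Rightarrow> real ^ 'c ^ 'a)"
    by (auto simp: bilinear_def linear_iff matrix_matrix_mult_def vec_eq_iff sum.distrib
        algebra_simps sum_distrib_left)
  then show ?thesis by (simp add: bilinear_conv_bounded_bilinear)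
qed

lemma bounded_linear_transpose:
  "bounded_linear (transpose :: real ^ 'b::finite ^ 'a::finite \<Rightarrow> real ^ 'a ^ 'b)"
  unfolding linear_conv_bounded_linear[symmetric]
  by (auto simp: linear_iff transpose_def vec_eq_iff)

interpretation mm: bounded_bilinear
  "(**) :: real ^ 'b::finite ^ 'a::finite \<Rightarrow> real ^ 'c::finite ^ 'b \<Rightarrow> real ^ 'c ^ 'a"
  by (rule bounded_bilinear_matrix_mult)

lemma transpose_add: "transpose (x + y) = transpose x + transpose y"
  and transpose_diff: "transpose (x - y) = transpose x - transpose y"
  and transpose_minus: "transpose (- x) = - transpose x"
  and transpose_scaleR: "transpose (c *\<^sub>R x) = c *\<^sub>R transpose x"
  for x y :: "real ^ 'b::finite ^ 'a::finite"
  by (simp_all add: transpose_def vec_eq_iff)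

lemma inner_matrix: "inner x y = (\<Sum>i\<in>UNIV. \<Sum>j\<in>UNIV. x $ i $ j * y $ i $ j)"
  for x y :: "real ^ 'b::finite ^ 'a::finite"
  by (simp add: inner_vec_def)

lemma trace_transpose_mult: "trace (transpose x ** y) = inner x y"
  for x y :: "real ^ 'b::finite ^ 'a::finite"
  unfolding inner_matrix trace_def matrix_matrix_mult_def transpose_def
  by simp (rule sum.swap)

lemma inner_transpose: "inner (transpose x) (transpose y) = inner x y"
  for x y :: "real ^ 'b::finite ^ 'a::finite"
  unfolding inner_matrix transpose_def by simp (rule sum.swap)

lemma inner_mult_left: "inner (a ** x) y = inner x (transpose a ** y)"
  for x :: "real ^ 'b::finite ^ 'c::finite" and y :: "real ^ 'b ^ 'a::finite"
  by (simp add: trace_transpose_mult[symmetric] matrix_transpose_mul matrix_mul_assoc)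

lemma inner_mult_right: "inner (x ** a) y = inner x (y ** transpose a)"
  for x :: "real ^ 'b::finite ^ 'c::finite" and y :: "real ^ 'a::finite ^ 'c"
  using inner_mult_left[of "transpose a" "transpose x" "transpose y"]
  by (simp add: matrix_transpose_mul[symmetric] inner_transpose)
    (metis inner_transpose matrix_transpose_mul transpose_transpose)

lemma stiefel_metric_inner:
  "stiefel_metric \<alpha> q u v = inner u v + (\<alpha> - 1) * inner (transpose q ** u) (transpose q ** v)"
  for q :: "real ^ 'p::finite ^ 'n::finite"
  unfolding stiefel_metric_def trace_transpose_mult[symmetric]
  by (simp add: matrix_transpose_mul matrix_mul_assoc)

section \<open>Tangent vectors of the Stiefel manifold\<close>

lemma Stiefel_iff: "q \<in> Stiefel \<longleftrightarrow> transpose q ** q = mat 1"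
  by (simp add: Stiefel_def)

lemma skew_inner_zero:
  fixes a :: "real ^ 'n::finite ^ 'n" and x :: "real ^ 'p::finite ^ 'n"
  assumes "transpose a = - a"
  shows "inner (a ** x) x = 0"
  using inner_mult_left[of a x x] assms by (simp add: inner_commute mm.minus_left)

text \<open>Since a is skew, a ** x is orthogonal to x, so this is Pythagoras. It gives injectivity
  of 1 - ta for every real t and at the same time bounds the inverse.\<close>

lemma norm_le_cayley:
  fixes a :: "real ^ 'n::finite ^ 'n" and x :: "real ^ 'p::finite ^ 'n"
  assumes "transpose a = - a"
  shows "norm x \<le> norm (x - t *\<^sub>R (a ** x))"
proof -
  have "(norm (x - t *\<^sub>R (a ** x)))\<^sup>2 = (norm x)\<^sup>2 + t\<^sup>2 * (norm (a ** x))\<^sup>2"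
    unfolding power2_norm_eq_inner using skew_inner_zero[OF assms, of x]
    by (simp add: inner_diff_left inner_diff_right inner_commute power2_eq_square)
  then have "(norm x)\<^sup>2 \<le> (norm (x - t *\<^sub>R (a ** x)))\<^sup>2" by simp
  then show ?thesis by (rule power2_le_imp_le) simp
qed

text \<open>The velocity \<open>a ** q\<close> is realised by the Cayley transform: the curve is
  \<open>(1 - ta/2)\<^sup>-\<^sup>1 (1 + ta/2) q\<close>.\<close>

lemma skew_mult_tangent:
  fixes a :: "real ^ 'n::finite ^ 'n" and q :: "real ^ 'p::finite ^ 'n"
  assumes a: "transpose a = - a" and q: "q \<in> Stiefel"
  shows "a ** q \<in> tangent_space Stiefel q"
proof -
  define T where "T t x = x - (t / 2) *\<^sub>R (a ** x)" for t and x :: "real ^ 'p ^ 'n"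
  have norm_le: "norm x \<le> norm (T t x)" for t x
    unfolding T_def using norm_le_cayley[OF a] by blast
  have lin: "linear (T t)" for t
    unfolding T_def by (auto simp: linear_iff mm.add_right mm.scaleR_right algebra_simps)
  have "x = 0" if "T t x = 0" for t x
    using norm_le[of x t] that by simp
  then have "inj (T t)" for t
    using linear_injective_0[OF lin[of t]] by blast
  then have "surj (T t)" for t
    using linear_injective_imp_surjective[OF lin[of t]] by blast
  define d where "d t = inv (T t) q" for t
  have d: "T t (d t) = q" for t
    unfolding d_def using \<open>surj (T t)\<close> by (rule surj_f_inv_f)
  define c where "c t = q + t *\<^sub>R (a ** d t)" for t
  have d_eq: "q = d t - (t / 2) *\<^sub>R (a ** d t)" for t
    using d[of t] by (simp add: T_def)
  have c_eq: "c t = d t + (t / 2) *\<^sub>R (a ** d t)" for t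
  proof -
    have "c t = (d t - (t / 2) *\<^sub>R (a ** d t)) + t *\<^sub>R (a ** d t)"
      unfolding c_def using d_eq[of t] by simp
    also have "\<dots> = d t + (t / 2) *\<^sub>R (a ** d t)"
      by (simp add: vec_eq_iff field_simps)
    finally show ?thesis .
  qed
  have "c t \<in> Stiefel" for t
  proof -
    \<comment> \<open>For skew a both sides equal transpose D ** (1 - r^2 a^2) ** D, which is even
      in r.\<close>
    have "transpose (D + r *\<^sub>R (a ** D)) ** (D + r *\<^sub>R (a ** D))
        = transpose (D - r *\<^sub>R (a ** D)) ** (D - r *\<^sub>R (a ** D))" for r and D :: "real ^ 'p ^ 'n"
      by (simp add: transpose_add transpose_diff transpose_scaleR matrix_transpose_mul a mm.add_left
          mm.add_right mm.diff_left mm.diff_right mm.scaleR_left mm.scaleR_right mm.minus_left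
          mm.minus_right matrix_mul_assoc) (simp add: vec_eq_iff algebra_simps)
    from this[of "d t" "t / 2"] have "transpose (c t) ** c t = transpose q ** q"
      unfolding c_eq d_eq[of t, symmetric] .
    then show ?thesis using q by (simp add: Stiefel_iff)
  qed
  moreover have "c 0 = q" by (simp add: c_def)
  moreover have "(c has_vector_derivative a ** q) (at 0)"
  proof -
    \<comment> \<open>The difference quotient of c at 0 is exactly a ** d t, so only continuity of d
      at 0 has to be shown, not differentiability of the inverse.\<close>
    have bd: "norm (d t) \<le> norm q" for t using norm_le[of "d t" t] d by simp
    obtain K where K: "norm (a ** x) \<le> norm x * K" for x :: "real ^ 'p ^ 'n"
      using bounded_linear.bounded[OF mm.bounded_linear_right] by blast
    have "norm (d t - q) \<le> \<bar>t\<bar> * (\<bar>K\<bar> * norm q)" for t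
    proof -
      have "d t - q = (t / 2) *\<^sub>R (a ** d t)" using d_eq[of t] by (simp add: algebra_simps)
      then have "norm (d t - q) = \<bar>t\<bar> / 2 * norm (a ** d t)" by simp
      also have "\<dots> \<le> \<bar>t\<bar> * (norm q * \<bar>K\<bar>)"
      proof (rule mult_mono)
        have "norm (a ** d t) \<le> norm (d t) * \<bar>K\<bar>"
          using K[of "d t"] by (meson abs_ge_self mult_left_mono norm_ge_zero order_trans)
        also have "\<dots> \<le> norm q * \<bar>K\<bar>" using bd by (intro mult_right_mono) auto
        finally show "norm (a ** d t) \<le> norm q * \<bar>K\<bar>" .
      qed auto
      finally show ?thesis by (simp add: ac_simps)
    qed
    then have "\<forall>\<^sub>F t in at 0. norm (d t - q) \<le> \<bar>t\<bar> * (\<bar>K\<bar> * norm q)"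
      by (simp add: always_eventually)
    moreover have "((\<lambda>t::real. \<bar>t\<bar> * (\<bar>K\<bar> * norm q)) \<longlongrightarrow> 0) (at 0)"
      by (rule tendsto_mult_left_zero, rule tendsto_rabs_zero, rule tendsto_ident_at)
    ultimately have "(d \<longlongrightarrow> q) (at 0)"
      by (rule LIM_zero_cancel[OF Lim_null_comparison])
    then have "((\<lambda>t. a ** d t) \<longlongrightarrow> a ** q) (at 0)"
      by (intro mm.tendsto tendsto_const)
    then have lim: "((\<lambda>t. norm (a ** d t - a ** q)) \<longlongrightarrow> 0) (at 0)"
      by (intro tendsto_norm_zero LIM_zero)
    have "norm (a ** d t - a ** q) = norm (c (0 + t) - c 0 - t *\<^sub>R (a ** q)) / norm t" if "t \<noteq> 0" for t
    proof -
      have "c (0 + t) - c 0 - t *\<^sub>R (a ** q) = t *\<^sub>R (a ** d t - a ** q)"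
        by (simp add: c_def algebra_simps)
      then show ?thesis using that by simp
    qed
    then have "((\<lambda>t. norm (c (0 + t) - c 0 - t *\<^sub>R (a ** q)) / norm t) \<longlongrightarrow> 0) (at 0)"
      by (intro Lim_transform_eventually[OF lim]) (auto simp: eventually_at intro!: exI[of _ 1])
    then show ?thesis
      by (simp add: has_vector_derivative_def has_derivative_at bounded_linear_scaleR_left)
  qed
  ultimately show ?thesis unfolding tangent_space_def by blast
qed

text \<open>For a tangent vector v = q ** A + w with A skew and transpose q ** w = 0 this is q A q'
  + w q' - q w', where ' is transposition: the skew matrix with block A on the column space of q,
  off-diagonal block w, and zero block on the orthogonal complement.\<close>

definition tangent_skew :: "real ^ 'p ^ 'n \<Rightarrow> real ^ 'p ^ 'n \<Rightarrow> real ^ 'n ^ 'n::finite" where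
  "tangent_skew q v =
    v ** transpose q - q ** transpose v - q ** transpose q ** v ** transpose q"

lemma tangent_skew:
  fixes q v :: "real ^ 'p::finite ^ 'n::finite"
  assumes q: "transpose q ** q = mat 1" and v: "transpose q ** v + transpose v ** q = 0"
  shows "transpose (tangent_skew q v) = - tangent_skew q v" and "tangent_skew q v ** q = v"
proof -
  have vq: "transpose v ** q = - (transpose q ** v)" using v by (simp add: eq_neg_iff_add_eq_0 add.commute)
  have 1: "q ** transpose v ** q ** transpose q = - (q ** transpose q ** v ** transpose q)"
  proof -
    have "q ** (transpose v ** q) ** transpose q = - (q ** transpose q ** v ** transpose q)"
      unfolding vq by (simp add: mm.minus_left mm.minus_right matrix_mul_assoc)
    then show ?thesis by (simp add: matrix_mul_assoc)
  qed
  show "transpose (tangent_skew q v) = - tangent_skew q v"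
    using 1 unfolding tangent_skew_def
    by (simp add: transpose_diff matrix_transpose_mul matrix_mul_assoc)
  have 2: "m ** transpose q ** q = m" for m :: "real ^ 'p ^ 'n"
    using q by (simp flip: matrix_mul_assoc)
  show "tangent_skew q v ** q = v"
    unfolding tangent_skew_def mm.diff_left 2
    using vq by (simp add: mm.minus_right flip: matrix_mul_assoc)
qed

text \<open>One inclusion differentiates the defining equation along a curve; for the other,
  \<open>tangent_skew\<close> writes v as a ** q with a skew.\<close>

lemma tangent_space_Stiefel:
  fixes q :: "real ^ 'p::finite ^ 'n::finite"
  assumes q: "q \<in> Stiefel"
  shows "tangent_space Stiefel q = {v. transpose q ** v + transpose v ** q = 0}"
proof (intro set_eqI iffI)
  fix v assume "v \<in> tangent_space Stiefel q"
  then obtain c where c: "\<And>t. c t \<in> Stiefel" "c 0 = q" "(c has_vector_derivative v) (at 0)"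
    unfolding tangent_space_def by blast
  have "(c has_derivative (\<lambda>t. t *\<^sub>R v)) (at 0)"
    using c(3) by (simp add: has_vector_derivative_def)
  from mm.FDERIV[OF bounded_linear.has_derivative[OF bounded_linear_transpose this] this]
  have "((\<lambda>t. transpose (c t) ** c t) has_derivative
      (\<lambda>h. transpose (c 0) ** (h *\<^sub>R v) + transpose (h *\<^sub>R v) ** c 0)) (at 0)" .
  moreover have "(\<lambda>t. transpose (c t) ** c t) = (\<lambda>t. mat 1)"
    using c(1) by (auto simp: Stiefel_iff)
  ultimately have "(\<lambda>h. transpose (c 0) ** (h *\<^sub>R v) + transpose (h *\<^sub>R v) ** c 0) = (\<lambda>h::real. 0)"
    using has_derivative_unique[OF _ has_derivative_const] by simp
  from fun_cong[OF this, of 1] show "v \<in> {v. transpose q ** v + transpose v ** q = 0}"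
    by (simp add: c(2))
next
  fix v assume "v \<in> {v. transpose q ** v + transpose v ** q = 0}"
  then have v: "transpose q ** v + transpose v ** q = 0" by simp
  have q': "transpose q ** q = mat 1" using q by (simp add: Stiefel_iff)
  show "v \<in> tangent_space Stiefel q"
    using skew_mult_tangent[OF tangent_skew(1)[OF q' v] q] tangent_skew(2)[OF q' v] by simp
qed

section \<open>The Levi-Civita connection\<close>

text \<open>The first summand is normal to the manifold and restores tangency of the ambient derivative;
  the second is tangent and compensates the weight \<open>\<alpha> - 1\<close> of the metric.\<close>

definition christoffel ::
    "real \<Rightarrow> real ^ 'p::finite ^ 'n::finite \<Rightarrow> real ^ 'p ^ 'n \<Rightarrow> real ^ 'p ^ 'n \<Rightarrow> real ^ 'p ^ 'n" where
  "christoffel \<alpha> q x z = (1/2) *\<^sub>R (q ** (transpose x ** z + transpose z ** x))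
    + (1 - \<alpha>) *\<^sub>R ((x ** transpose z + z ** transpose x) ** q
        - q ** (transpose q ** ((x ** transpose z + z ** transpose x) ** q)))"

definition stiefel_connection ::
    "real \<Rightarrow> (real ^ 'p::finite ^ 'n::finite \<Rightarrow> real ^ 'p ^ 'n) \<Rightarrow> (real ^ 'p ^ 'n \<Rightarrow> real ^ 'p ^ 'n)
      \<Rightarrow> real ^ 'p ^ 'n \<Rightarrow> real ^ 'p ^ 'n" where
  "stiefel_connection \<alpha> X Z q = frechet_derivative Z (at q) (X q) + christoffel \<alpha> q (X q) (Z q)"

lemma smooth_matrix_mult:
  fixes f :: "'e::euclidean_space \<Rightarrow> real ^ 'b::finite ^ 'a::finite"
    and h :: "'e \<Rightarrow> real ^ 'c::finite ^ 'b"
  shows "smooth f \<Longrightarrow> smooth h \<Longrightarrow> smooth (\<lambda>x. f x ** h x)"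
  by (rule smooth_bilinear[OF bounded_bilinear_matrix_mult])

lemma smooth_transpose:
  fixes f :: "'e::euclidean_space \<Rightarrow> real ^ 'b::finite ^ 'a::finite"
  shows "smooth f \<Longrightarrow> smooth (\<lambda>x. transpose (f x))"
  by (rule smooth_linear_compose[OF bounded_linear_transpose])

lemmas smooth_intros = smooth_add smooth_diff smooth_scaleR smooth_matrix_mult smooth_transpose
  smooth_const smooth_deriv_along smooth_linear[OF bounded_linear_ident]

lemma vector_field_Stiefel_iff:
  "X \<in> vector_fields Stiefel \<longleftrightarrow>
    smooth X \<and> (\<forall>q\<in>Stiefel. transpose q ** X q + transpose (X q) ** q = 0)"
  for X :: "real ^ 'p::finite ^ 'n::finite \<Rightarrow> real ^ 'p ^ 'n"
  by (auto simp: vector_fields_def tangent_space_Stiefel)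

lemma christoffel_commute: "christoffel \<alpha> q x z = christoffel \<alpha> q z x"
  by (simp add: christoffel_def add.commute)

lemma christoffel_linear:
  "christoffel \<alpha> q (x + x') z = christoffel \<alpha> q x z + christoffel \<alpha> q x' z"
  "christoffel \<alpha> q (c *\<^sub>R x) z = c *\<^sub>R christoffel \<alpha> q x z"
  "christoffel \<alpha> q x (z + z') = christoffel \<alpha> q x z + christoffel \<alpha> q x z'"
  "christoffel \<alpha> q x (c *\<^sub>R z) = c *\<^sub>R christoffel \<alpha> q x z"
  by (simp_all add: christoffel_def transpose_add transpose_scaleR mm.add_left mm.add_right
      mm.scaleR_left mm.scaleR_right algebra_simps)

lemma christoffel_diff_left: "christoffel \<alpha> q (x - x') z = christoffel \<alpha> q x z - christoffel \<alpha> q x' z"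
  using christoffel_linear(1)[of \<alpha> q "x - x'" x' z] by simp

text \<open>The bracket weighted by 1 - \<alpha> has the form m - q ** (transpose q ** m), which
  transpose q annihilates on the manifold.\<close>

lemma transpose_mult_christoffel:
  fixes q x z :: "real ^ 'p::finite ^ 'n::finite"
  assumes "q \<in> Stiefel"
  shows "transpose q ** christoffel \<alpha> q x z
    = (1/2) *\<^sub>R (transpose x ** z + transpose z ** x)"
proof -
  have "transpose q ** (q ** m) = m" for m :: "real ^ 'p ^ 'p"
    using assms by (simp add: Stiefel_iff matrix_mul_assoc)
  then show ?thesis
    by (simp add: christoffel_def mm.add_right mm.diff_right mm.scaleR_right)
qed

text \<open>The right-hand side is the derivative of \<open>stiefel_metric \<alpha> q z w\<close> in
  the base point along x. This is what metric compatibility amounts to once the ambient derivatives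
  of the two fields are split off.\<close>

lemma christoffel_metric:
  fixes q x z w :: "real ^ 'p::finite ^ 'n::finite"
  assumes q: "q \<in> Stiefel"
    and x: "transpose q ** x + transpose x ** q = 0"
    and z: "transpose q ** z + transpose z ** q = 0"
    and w: "transpose q ** w + transpose w ** q = 0"
  shows "stiefel_metric \<alpha> q (christoffel \<alpha> q x z) w + stiefel_metric \<alpha> q z (christoffel \<alpha> q x w)
    = (\<alpha> - 1) * (inner (transpose x ** z) (transpose q ** w) + inner (transpose q ** z) (transpose x ** w))"
proof -
  define A B C where ABC: "A = transpose q ** x" "B = transpose q ** z" "C = transpose q ** w"
  have t: "transpose x ** q = - A" "transpose z ** q = - B" "transpose w ** q = - C"
    using x z w unfolding ABC by (simp_all add: eq_neg_iff_add_eq_0 add.commute)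
  have skew: "transpose A = - A" "transpose B = - B" "transpose C = - C"
    using t unfolding ABC by (simp_all add: matrix_transpose_mul)
  \<comment> \<open>Stated for arbitrary vectors so that it can be used again with z and w
    exchanged. The normal part of \<open>christoffel\<close> drops out, as a symmetric matrix is
    orthogonal to the skew C.\<close>
  have half: "stiefel_metric \<alpha> q (christoffel \<alpha> q x z) w = (1 - \<alpha>) *
      (- inner (x ** B) w - inner (z ** A) w + inner (A ** B + B ** A) C)"
    if t: "transpose x ** q = - A" "transpose z ** q = - B" "transpose w ** q = - C"
      and skew: "transpose A = - A" "transpose B = - B" "transpose C = - C"
      and ABC: "A = transpose q ** x" "B = transpose q ** z" "C = transpose q ** w"
    for x z w A B C
  proof -
    have sym: "inner (m + transpose m) C = 0" for m
      using inner_transpose[of m C] skew(3) by (simp add: inner_add_left)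
    have 1: "inner (transpose q ** christoffel \<alpha> q x z) (transpose q ** w) = 0"
      unfolding transpose_mult_christoffel[OF q] using sym[of "transpose x ** z"]
      by (simp add: matrix_transpose_mul ABC)
    have 2: "(x ** transpose z + z ** transpose x) ** q = - (x ** B) - z ** A"
      by (simp add: mm.add_left t mm.minus_right flip: matrix_mul_assoc)
    have 3: "transpose q ** (- (x ** B) - z ** A) = - (A ** B) - B ** A"
      by (simp add: mm.diff_right mm.minus_right matrix_mul_assoc ABC)
    have 4: "inner (q ** m) w = inner m C" for m :: "real ^ 'p ^ 'p"
      by (simp add: inner_mult_left ABC)
    show ?thesis
      unfolding stiefel_metric_inner 1
      using sym[of "transpose x ** z"]
      by (simp add: christoffel_def 2 3 4 inner_add_left inner_diff_left matrix_transpose_mul algebra_simps)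
  qed
  have comm: "stiefel_metric \<alpha> q u v = stiefel_metric \<alpha> q v u" for u v
    by (simp add: stiefel_metric_inner inner_commute)
  \<comment> \<open>Moving a skew factor across the inner product changes the sign. Hence the terms
    with z ** A, A ** B and B ** A cancel against their counterparts after the exchange of z and w,
    and only those with x ** B and x ** C survive.\<close>
  have e1: "inner (z ** A) w = - inner (w ** A) z" 
    using inner_mult_right[of z A w] unfolding skew by (simp add: mm.minus_right inner_commute)
  have e2: "inner (x ** B) w = inner B (transpose x ** w)" "inner (x ** C) z = inner C (transpose x ** z)"
    by (simp_all add: inner_mult_left)
  have e3: "inner (A ** B) C = - inner (A ** C) B" 
    using inner_mult_left[of A B C] unfolding skew by (simp add: mm.minus_left inner_commute)
  have e4: "inner (B ** A) C = - inner (C ** A) B" 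
    using inner_mult_right[of B A C] unfolding skew by (simp add: mm.minus_right inner_commute)
  show ?thesis
    using half[OF t skew ABC] half[OF t(1,3,2) skew(1,3,2) ABC(1,3,2)] e1 e2 e3 e4
    unfolding comm[of z]
    by (simp add: inner_add_left ABC(2,3)[symmetric] algebra_simps inner_commute[of C] inner_commute[of B])
qed

text \<open>The tangency equation of Z holds on the manifold only, so it is differentiated along a
  curve in it with velocity X q. The two terms without a derivative of Z are what the normal part of
  \<open>christoffel\<close> compensates.\<close>

lemma tangent_deriv_along:
  fixes X Z :: "real ^ 'p::finite ^ 'n::finite \<Rightarrow> real ^ 'p ^ 'n"
  assumes X: "X \<in> vector_fields Stiefel" and Z: "Z \<in> vector_fields Stiefel" and q: "q \<in> Stiefel"
  shows "transpose q ** frechet_derivative Z (at q) (X q) + transpose (X q) ** Z q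
    + (transpose (Z q) ** X q + transpose (frechet_derivative Z (at q) (X q)) ** q) = 0"
proof -
  have "X q \<in> tangent_space Stiefel q"
    using X q by (simp add: vector_fields_def)
  then obtain c where c: "\<And>t. c t \<in> Stiefel" "c 0 = q" "(c has_vector_derivative X q) (at 0)"
    unfolding tangent_space_def by blast
  define L where "L = frechet_derivative Z (at q)"
  have dc: "(c has_derivative (\<lambda>t. t *\<^sub>R X q)) (at 0)"
    using c(3) by (simp add: has_vector_derivative_def)
  have dZ: "(Z has_derivative L) (at (c 0))"
    using Z unfolding L_def c(2) by (simp add: vector_fields_def smooth_has_derivative)
  have dZc: "((\<lambda>t. Z (c t)) has_derivative (\<lambda>t. L (t *\<^sub>R X q))) (at 0)"
    using has_derivative_compose[OF dc dZ] .
  have "((\<lambda>t. transpose (c t) ** Z (c t) + transpose (Z (c t)) ** c t) has_derivative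
     (\<lambda>h. (transpose (c 0) ** L (h *\<^sub>R X q) + transpose (h *\<^sub>R X q) ** Z (c 0))
        + (transpose (Z (c 0)) ** (h *\<^sub>R X q) + transpose (L (h *\<^sub>R X q)) ** c 0))) (at 0)"
    by (intro has_derivative_add mm.FDERIV bounded_linear.has_derivative[OF bounded_linear_transpose]
        dc dZc)
  moreover have "(\<lambda>t. transpose (c t) ** Z (c t) + transpose (Z (c t)) ** c t) = (\<lambda>t. 0)"
    using Z c(1) by (auto simp: vector_field_Stiefel_iff)
  ultimately have "(\<lambda>h. (transpose (c 0) ** L (h *\<^sub>R X q) + transpose (h *\<^sub>R X q) ** Z (c 0))
        + (transpose (Z (c 0)) ** (h *\<^sub>R X q) + transpose (L (h *\<^sub>R X q)) ** c 0)) = (\<lambda>h::real. 0)"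
    using has_derivative_unique[OF _ has_derivative_const] by simp
  from fun_cong[OF this, of 1] show ?thesis
    by (simp add: c(2) L_def)
qed

lemma smooth_stiefel_connection:
  assumes "smooth X" "smooth Z"
  shows "smooth (stiefel_connection \<alpha> X Z)"
proof -
  have "smooth (\<lambda>q. stiefel_connection \<alpha> X Z q)"
    unfolding stiefel_connection_def christoffel_def
    by (intro smooth_intros assms)
  then show ?thesis by simp
qed

lemma stiefel_connection_vector_field:
  fixes X Z :: "real ^ 'p::finite ^ 'n::finite \<Rightarrow> real ^ 'p ^ 'n"
  assumes X: "X \<in> vector_fields Stiefel" and Z: "Z \<in> vector_fields Stiefel"
  shows "stiefel_connection \<alpha> X Z \<in> vector_fields Stiefel"
  unfolding vector_field_Stiefel_iff
proof (intro conjI ballI)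
  show "smooth (stiefel_connection \<alpha> X Z)"
    using X Z by (simp add: smooth_stiefel_connection vector_fields_def)
  fix q :: "real ^ 'p ^ 'n" assume q: "q \<in> Stiefel"
  have 1: "transpose q ** christoffel \<alpha> q (X q) (Z q)
    = (1/2) *\<^sub>R (transpose (X q) ** Z q + transpose (Z q) ** X q)"
    by (rule transpose_mult_christoffel[OF q])
  have "transpose (christoffel \<alpha> q (X q) (Z q)) ** q
      = transpose (transpose q ** christoffel \<alpha> q (X q) (Z q))"
    by (simp add: matrix_transpose_mul)
  also have "\<dots> = (1/2) *\<^sub>R (transpose (X q) ** Z q + transpose (Z q) ** X q)"
    unfolding 1 by (simp add: transpose_scaleR transpose_add matrix_transpose_mul add.commute)
  finally have 2: "transpose (christoffel \<alpha> q (X q) (Z q)) ** q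
      = (1/2) *\<^sub>R (transpose (X q) ** Z q + transpose (Z q) ** X q)" .
  have 3: "(1/2) *\<^sub>R m + (1/2) *\<^sub>R m = m" for m :: "real ^ 'p ^ 'p"
    by (simp flip: scaleR_add_left)
  show "transpose q ** stiefel_connection \<alpha> X Z q + transpose (stiefel_connection \<alpha> X Z q) ** q = 0"
    using tangent_deriv_along[OF X Z q] 3[of "transpose (X q) ** Z q + transpose (Z q) ** X q"]
    unfolding stiefel_connection_def mm.add_right transpose_add mm.add_left 1 2
    by (simp add: algebra_simps)
qed

text \<open>Torsion-freeness is the symmetry of \<open>christoffel\<close>, metric compatibility is
  \<open>christoffel_metric\<close>; the linearity and Leibniz axioms come from bilinearity of
  \<open>christoffel\<close> and the product rule.\<close>

lemma levi_civita_stiefel_connection: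
  "levi_civita (Stiefel :: (real ^ 'p::finite ^ 'n::finite) set) (stiefel_connection \<alpha>) (stiefel_metric \<alpha>)"
proof
  fix X X' Z Z' W :: "real ^ 'p ^ 'n \<Rightarrow> real ^ 'p ^ 'n" and f h :: "real ^ 'p ^ 'n \<Rightarrow> real"
    and p :: "real ^ 'p ^ 'n"
  let ?V = "vector_fields (Stiefel :: (real ^ 'p ^ 'n) set)"
  let ?D = "\<lambda>Z. frechet_derivative Z (at p)"
  have der: "(Z has_derivative ?D Z) (at p)" if "Z \<in> ?V" for Z
    using that by (simp add: vector_fields_def smooth_has_derivative)
  show "stiefel_connection \<alpha> X Z \<in> ?V" if "X \<in> ?V" "Z \<in> ?V"
    using stiefel_connection_vector_field that by blast
  show "stiefel_connection \<alpha> (\<lambda>q. f q *\<^sub>R X q + h q *\<^sub>R X' q) Z p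
      = f p *\<^sub>R stiefel_connection \<alpha> X Z p + h p *\<^sub>R stiefel_connection \<alpha> X' Z p"
    if "Z \<in> ?V"
  proof -
    interpret linear "?D Z" using has_derivative_linear[OF der[OF that]] .
    show ?thesis
      by (simp add: stiefel_connection_def add scaleR christoffel_linear algebra_simps)
  qed
  show "stiefel_connection \<alpha> X (\<lambda>q. Z q + Z' q) p
      = stiefel_connection \<alpha> X Z p + stiefel_connection \<alpha> X Z' p"
    if "Z \<in> ?V" "Z' \<in> ?V"
    using frechet_derivative_at[OF has_derivative_add[OF der[OF that(1)] der[OF that(2)]], symmetric]
    by (simp add: stiefel_connection_def christoffel_linear algebra_simps)
  show "stiefel_connection \<alpha> X (\<lambda>q. f q *\<^sub>R Z q) p
      = deriv_along X f p *\<^sub>R Z p + f p *\<^sub>R stiefel_connection \<alpha> X Z p"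
    if "Z \<in> ?V" "smooth f"
  proof -
    have d: "((\<lambda>q. f q *\<^sub>R Z q) has_derivative (\<lambda>v. f p *\<^sub>R ?D Z v + ?D f v *\<^sub>R Z p)) (at p)"
      by (rule bounded_bilinear.FDERIV[OF bounded_bilinear_scaleR smooth_has_derivative[OF that(2)]
          der[OF that(1)]])
    show ?thesis
      using frechet_derivative_at[OF d, symmetric]
      by (simp add: stiefel_connection_def deriv_along_def christoffel_linear algebra_simps)
  qed
  show "stiefel_connection \<alpha> X Z p - stiefel_connection \<alpha> Z X p = lie_bracket X Z p"
    using christoffel_commute[of \<alpha> p "X p" "Z p"]
    by (simp add: stiefel_connection_def lie_bracket_def deriv_along_def)
  show "deriv_along X (\<lambda>q. stiefel_metric \<alpha> q (Z q) (W q)) p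
      = stiefel_metric \<alpha> p (stiefel_connection \<alpha> X Z p) (W p)
        + stiefel_metric \<alpha> p (Z p) (stiefel_connection \<alpha> X W p)"
    if "X \<in> ?V" "Z \<in> ?V" "W \<in> ?V" "p \<in> Stiefel"
  proof -
    have id: "((\<lambda>q. transpose q) has_derivative (\<lambda>v. transpose v)) (at p)"
      by (rule bounded_linear_imp_has_derivative[OF bounded_linear_transpose])
    have "((\<lambda>q. inner (Z q) (W q) + (\<alpha> - 1) * inner (transpose q ** Z q) (transpose q ** W q))
      has_derivative (\<lambda>v. (inner (Z p) (?D W v) + inner (?D Z v) (W p))
        + (\<alpha> - 1) * (inner (transpose p ** Z p) (transpose p ** ?D W v + transpose v ** W p)
          + inner (transpose p ** ?D Z v + transpose v ** Z p) (transpose p ** W p)))) (at p)"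
      by (intro has_derivative_add has_derivative_mult_right has_derivative_inner mm.FDERIV id der that)
    from frechet_derivative_at[OF this, symmetric]
    have "deriv_along X (\<lambda>q. stiefel_metric \<alpha> q (Z q) (W q)) p
      = stiefel_metric \<alpha> p (?D Z (X p)) (W p) + stiefel_metric \<alpha> p (Z p) (?D W (X p))
        + (\<alpha> - 1) * (inner (transpose (X p) ** Z p) (transpose p ** W p)
          + inner (transpose p ** Z p) (transpose (X p) ** W p))"
      unfolding deriv_along_def stiefel_metric_inner
      by (simp add: inner_add_left inner_add_right algebra_simps)
    also have "\<dots> = stiefel_metric \<alpha> p (stiefel_connection \<alpha> X Z p) (W p)
        + stiefel_metric \<alpha> p (Z p) (stiefel_connection \<alpha> X W p)"
      using christoffel_metric[of p "X p" "Z p" "W p" \<alpha>] that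
      by (simp add: vector_field_Stiefel_iff stiefel_connection_def stiefel_metric_inner mm.add_right
          inner_add_left inner_add_right algebra_simps)
    finally show ?thesis .
  qed
qed

section \<open>The curvature of linear fields\<close>

definition christoffel_deriv ::
    "real \<Rightarrow> real ^ 'p::finite ^ 'n::finite \<Rightarrow> real ^ 'p ^ 'n \<Rightarrow> real ^ 'p ^ 'n \<Rightarrow> real ^ 'p ^ 'n \<Rightarrow> real ^ 'p ^ 'n" where
  "christoffel_deriv \<alpha> q w x z = (1/2) *\<^sub>R (w ** (transpose x ** z + transpose z ** x))
    + (1 - \<alpha>) *\<^sub>R ((x ** transpose z + z ** transpose x) ** w
        - w ** (transpose q ** ((x ** transpose z + z ** transpose x) ** q))
        - q ** (transpose w ** ((x ** transpose z + z ** transpose x) ** q))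
        - q ** (transpose q ** ((x ** transpose z + z ** transpose x) ** w)))"

text \<open>The classical expression of R(x,y)y by Christoffel symbols and their first derivatives,
  in ambient coordinates; \<open>christoffel_deriv\<close> differentiates in the base point with x
  and z frozen.\<close>

definition curvature_tensor ::
    "real \<Rightarrow> real ^ 'p::finite ^ 'n::finite \<Rightarrow> real ^ 'p ^ 'n \<Rightarrow> real ^ 'p ^ 'n \<Rightarrow> real ^ 'p ^ 'n" where
  "curvature_tensor \<alpha> q x y = christoffel_deriv \<alpha> q x y y - christoffel_deriv \<alpha> q y x y
    + christoffel \<alpha> q x (christoffel \<alpha> q y y) - christoffel \<alpha> q y (christoffel \<alpha> q x y)"

lemma has_derivative_christoffel_fields:
  fixes a b :: "real ^ 'n::finite ^ 'n" and q :: "real ^ 'p::finite ^ 'n"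
  shows "((\<lambda>q. christoffel \<alpha> q (a ** q) (b ** q)) has_derivative
    (\<lambda>w. christoffel_deriv \<alpha> q w (a ** q) (b ** q) + christoffel \<alpha> q (a ** w) (b ** q)
      + christoffel \<alpha> q (a ** q) (b ** w))) (at q)"
proof -
  have id: "((\<lambda>q. transpose (c ** q)) has_derivative (\<lambda>v. transpose (c ** v))) (at q)"
    "((\<lambda>q. c ** q) has_derivative (\<lambda>v. c ** v)) (at q)" for c :: "real ^ 'n ^ 'n" and q :: "real ^ 'p ^ 'n"
    by (intro bounded_linear.has_derivative[OF bounded_linear_transpose]
        bounded_linear.has_derivative[OF mm.bounded_linear_right] has_derivative_ident)+
  have id': "((\<lambda>q. transpose q) has_derivative (\<lambda>v. transpose v)) (at q)" for q :: "real ^ 'p ^ 'n"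
    by (rule bounded_linear_imp_has_derivative[OF bounded_linear_transpose])
  note d = mm.FDERIV[OF id(1) id(2), of a b q] mm.FDERIV[OF id(1) id(2), of b a q]
    mm.FDERIV[OF id(2) id(1), of a b q] mm.FDERIV[OF id(2) id(1), of b a q]
  note d12 = has_derivative_add[OF d(1) d(2)]
  note d34 = mm.FDERIV[OF has_derivative_add[OF d(3) d(4)] has_derivative_ident[of "at q"]]
  note d1 = has_derivative_scaleR_right[OF mm.FDERIV[OF has_derivative_ident d12], of "1/2"]
  note d2 = has_derivative_scaleR_right[OF has_derivative_diff[OF d34
        mm.FDERIV[OF has_derivative_ident mm.FDERIV[OF id' d34]]], of "1 - \<alpha>"]
  show ?thesis
    unfolding christoffel_def
    by (rule has_derivative_eq_rhs[OF has_derivative_add[OF d1 d2]])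
      (simp add: fun_eq_iff christoffel_def christoffel_deriv_def mm.add_left mm.add_right
        scaleR_add_right scaleR_diff_right algebra_simps)
qed

lemma linear_field:
  fixes a :: "real ^ 'n::finite ^ 'n"
  assumes "transpose a = - a"
  shows "(\<lambda>q. a ** q) \<in> vector_fields (Stiefel :: (real ^ 'p::finite ^ 'n) set)"
  using skew_mult_tangent[OF assms] unfolding vector_fields_def
  by (auto intro: smooth_linear mm.bounded_linear_right)

text \<open>Terms in which a field is differentiated cancel in pairs or against the bracket field,
  which is again linear, with matrix b ** a - a ** b. The identity is algebraic and holds at every
  matrix q.\<close>

lemma curvature_linear_fields:
  fixes a b :: "real ^ 'n::finite ^ 'n" and q :: "real ^ 'p::finite ^ 'n"
  shows "curvature (stiefel_connection \<alpha>) (\<lambda>q. a ** q) (\<lambda>q. b ** q) (\<lambda>q. b ** q) q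
    = curvature_tensor \<alpha> q (a ** q) (b ** q)"
proof -
  have fd: "frechet_derivative ((**) c) (at q) = (**) c" for c :: "real ^ 'n ^ 'n" and q :: "real ^ 'p ^ 'n"
    using frechet_derivative_at[OF bounded_linear_imp_has_derivative[OF mm.bounded_linear_right], symmetric] .
  \<comment> \<open>An equality of functions on the whole ambient space, since the outer connection
    differentiates the inner one.\<close>
  have D: "stiefel_connection \<alpha> (\<lambda>q :: real ^ 'p ^ 'n. c ** q) (\<lambda>q. d ** q)
      = (\<lambda>q. (d ** c) ** q + christoffel \<alpha> q (c ** q) (d ** q))" for c d :: "real ^ 'n ^ 'n"
    by (simp add: fun_eq_iff stiefel_connection_def fd matrix_mul_assoc)
  have DD: "stiefel_connection \<alpha> (\<lambda>q. e ** q) (\<lambda>q. (d ** c) ** q + christoffel \<alpha> q (c ** q) (d ** q)) q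
     = d ** (c ** (e ** q)) + (christoffel_deriv \<alpha> q (e ** q) (c ** q) (d ** q)
      + christoffel \<alpha> q (c ** (e ** q)) (d ** q) + christoffel \<alpha> q (c ** q) (d ** (e ** q)))
      + (christoffel \<alpha> q (e ** q) (d ** (c ** q))
        + christoffel \<alpha> q (e ** q) (christoffel \<alpha> q (c ** q) (d ** q)))" for c d e :: "real ^ 'n ^ 'n"
  proof -
    have "((\<lambda>q. (d ** c) ** q + christoffel \<alpha> q (c ** q) (d ** q)) has_derivative
      (\<lambda>w. (d ** c) ** w + (christoffel_deriv \<alpha> q w (c ** q) (d ** q)
      + christoffel \<alpha> q (c ** w) (d ** q) + christoffel \<alpha> q (c ** q) (d ** w)))) (at q)"
      by (intro has_derivative_add has_derivative_christoffel_fields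
          bounded_linear_imp_has_derivative[OF mm.bounded_linear_right])
    from frechet_derivative_at[OF this, symmetric] show ?thesis
      by (simp add: stiefel_connection_def christoffel_linear matrix_mul_assoc)
  qed
  have L: "lie_bracket (\<lambda>q :: real ^ 'p ^ 'n. a ** q) (\<lambda>q. b ** q) = (\<lambda>q. (b ** a - a ** b) ** q)"
    by (simp add: fun_eq_iff lie_bracket_def deriv_along_def fd mm.diff_left matrix_mul_assoc)
  show ?thesis
    unfolding curvature_def L D DD curvature_tensor_def
    using christoffel_commute[of \<alpha> q "a ** q" "b ** (b ** q)"]
      christoffel_commute[of \<alpha> q "b ** q" "b ** (a ** q)"]
      christoffel_commute[of \<alpha> q "b ** q" "a ** (b ** q)"]
    by (simp add: mm.diff_left mm.diff_right christoffel_diff_left algebra_simps flip: matrix_mul_assoc)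
qed

section \<open>Connectedness of the space of sections\<close>

text \<open>A predicate on pairs, because the set {x, y} collapses for x = y and would then count as
  independent whenever x is nonzero.\<close>

definition indep2 :: "'a::real_vector \<Rightarrow> 'a \<Rightarrow> bool" where
  "indep2 x y \<longleftrightarrow> (\<forall>r s. r *\<^sub>R x + s *\<^sub>R y = 0 \<longrightarrow> r = 0 \<and> s = 0)"

lemma indep2_commute: "indep2 x y \<longleftrightarrow> indep2 y x"
  unfolding indep2_def by (metis add.commute)

lemma indep2_nonzero: "indep2 x y \<Longrightarrow> x \<noteq> 0"
  unfolding indep2_def by (metis add.right_neutral scaleR_zero_left scaleR_zero_right zero_neq_one)

lemma indep2_if_notin_span:
  assumes "x \<noteq> 0" "w \<notin> span V" "x \<in> V"
  shows "indep2 x w"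
  unfolding indep2_def
proof (intro allI impI)
  fix r s assume eq: "r *\<^sub>R x + s *\<^sub>R w = 0"
  have "s = 0"
  proof (rule ccontr)
    assume "s \<noteq> 0"
    have "s *\<^sub>R w = - (r *\<^sub>R x)" using eq by (simp add: eq_neg_iff_add_eq_0 add.commute)
    then have "w = (- r / s) *\<^sub>R x" using \<open>s \<noteq> 0\<close> by (metis divide_inverse_commute
          scaleR_left_imp_eq scaleR_minus_left scaleR_scaleR right_inverse scaleR_one)
    then show False using assms by (simp add: span_base span_scale span_neg)
  qed
  then show "r = 0 \<and> s = 0" using eq assms by auto
qed

lemma dim_span_indep2:
  fixes x y :: "'a::euclidean_space"
  assumes "indep2 x y"
  shows "dim (span {x, y}) = 2"
proof -
  have "x \<notin> span {y}"
  proof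
    assume "x \<in> span {y}"
    then obtain k where "x = k *\<^sub>R y" by (auto simp: span_singleton)
    then have "1 *\<^sub>R x + (- k) *\<^sub>R y = 0" by simp
    then show False using assms unfolding indep2_def by (metis zero_neq_one)
  qed
  moreover have "y \<noteq> 0" using assms indep2_commute indep2_nonzero by blast
  ultimately have "independent {x, y}" "x \<noteq> y"
    by (auto simp: independent_insert span_base)
  then show ?thesis
    by (simp add: dim_eq_card_independent)
qed

lemma ex_notin_span:
  fixes T :: "'a::euclidean_space set"
  assumes "finite V" "card V < dim T"
  shows "\<exists>w\<in>T. w \<notin> span V"
proof (rule ccontr)
  assume "\<not> ?thesis"
  then have "T \<subseteq> span V" by blast
  then have "dim T \<le> dim V" using dim_subset[of T "span V"] by simp
  also have "\<dots> \<le> card V" using assms by (simp add: dim_le_card')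
  finally show False using assms by simp
qed

text \<open>On the segment from y to w, a dependence on x with a nonzero coefficient at w would put
  w into the span of x and y; otherwise it is a dependence of x and y. Both orders are stated, as
  either member of a pair may be the one that moves.\<close>

lemma path_component_indep2:
  fixes T :: "'a::euclidean_space set"
  defines "R \<equiv> {(x, y). x \<in> T \<and> y \<in> T \<and> indep2 x y}"
  assumes T: "subspace T" and xy: "(x, y) \<in> R" and w: "w \<in> T" "w \<notin> span {x, y}"
  shows "path_component R (x, y) (x, w)" "path_component R (y, x) (w, x)"
proof -
  have ind: "indep2 x ((1 - u) *\<^sub>R y + u *\<^sub>R w)" for u
    unfolding indep2_def
  proof (intro allI impI)
    fix r s assume eq: "r *\<^sub>R x + s *\<^sub>R ((1 - u) *\<^sub>R y + u *\<^sub>R w) = 0"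
    have "s * u = 0"
    proof (rule ccontr)
      assume "s * u \<noteq> 0"
      have "(s * u) *\<^sub>R w = (- r) *\<^sub>R x + (- (s * (1 - u))) *\<^sub>R y"
        using eq by (simp add: algebra_simps eq_neg_iff_add_eq_0)
      also have "\<dots> \<in> span {x, y}"
        by (intro span_add span_scale span_base) auto
      finally have "inverse (s * u) *\<^sub>R (s * u) *\<^sub>R w \<in> span {x, y}"
        by (rule span_scale)
      also have "inverse (s * u) *\<^sub>R (s * u) *\<^sub>R w = w"
        unfolding scaleR_scaleR using left_inverse[OF \<open>s * u \<noteq> 0\<close>] by simp
      finally have "w \<in> span {x, y}" .
      then show False using w by blast
    qed
    then have "s = 0 \<or> u = 0" by simp
    then have "r *\<^sub>R x + s *\<^sub>R y = 0" using eq by auto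
    then show "r = 0 \<and> s = 0" using xy unfolding R_def indep2_def by blast
  qed
  have mem: "(1 - u) *\<^sub>R y + u *\<^sub>R w \<in> T" for u
    using w xy by (intro subspace_add[OF T] subspace_scale[OF T]) (auto simp: R_def)
  have "closed_segment (x, y) (x, w) \<subseteq> R" "closed_segment (y, x) (w, x) \<subseteq> R"
  proof -
    have x: "(1 - u) *\<^sub>R x + u *\<^sub>R x = x" for u by (simp flip: scaleR_add_left)
    have ind': "indep2 ((1 - u) *\<^sub>R y + u *\<^sub>R w) x" for u
      using ind[of u] by (simp only: indep2_commute)
    have "x \<in> T" using xy by (simp add: R_def)
    then show "closed_segment (x, y) (x, w) \<subseteq> R" "closed_segment (y, x) (w, x) \<subseteq> R"
      using ind ind' mem by (auto simp: closed_segment_def R_def x)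
  qed
  then show "path_component R (x, y) (x, w)" "path_component R (y, x) (w, x)"
    by (auto intro: path_component_linepath)
qed

text \<open>The path is (x, y), (x, w), (u, w), (x', w), (x', y'). Dimension 5 provides w outside
  the span of all four given vectors; u then has to avoid only the span of x, x' and w.\<close>

lemma connected_indep2:
  fixes T :: "'a::euclidean_space set"
  assumes T: "subspace T" and dim: "5 \<le> dim T"
  shows "connected {(x, y). x \<in> T \<and> y \<in> T \<and> indep2 x y}" (is "connected ?R")
proof -
  have "path_component ?R (x, y) (x', y')"
    if a: "x \<in> T" "y \<in> T" "indep2 x y" "x' \<in> T" "y' \<in> T" "indep2 x' y'" for x y x' y'
  proof -
    have "card {x, y, x', y'} < dim T"
      using card_length[of "[x, y, x', y']"] dim by simp
    then obtain w where w: "w \<in> T" "w \<notin> span {x, y, x', y'}"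
      using ex_notin_span[of "{x, y, x', y'}" T] by auto
    have "card {x, x', w} < dim T"
      using card_length[of "[x, x', w]"] dim by simp
    then obtain u where u: "u \<in> T" "u \<notin> span {x, x', w}"
      using ex_notin_span[of "{x, x', w}" T] by auto
    have w': "w \<notin> span {x, y}" "w \<notin> span {x', y'}"
      using w(2) span_mono[of "{x, y}" "{x, y, x', y'}"] span_mono[of "{x', y'}" "{x, y, x', y'}"] by blast+
    have u': "u \<notin> span {w, x}" "u \<notin> span {w, x'}"
      using u(2) span_mono[of "{w, x}" "{x, x', w}"] span_mono[of "{w, x'}" "{x, x', w}"] by blast+
    have n: "x \<noteq> 0" "x' \<noteq> 0" "w \<noteq> 0"
      using a indep2_nonzero w(2) span_zero by blast+
    have i: "indep2 w x" "indep2 w x'"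
      using indep2_if_notin_span[OF _ w(2)] n indep2_commute by blast+
    have pc: "path_component ?R (x, y) (x, w)" "path_component ?R (x', y') (x', w)"
      "path_component ?R (x, w) (u, w)" "path_component ?R (x', w) (u, w)"
      using path_component_indep2[OF T] a w w' u u' i by auto
    then show ?thesis
      by (intro path_component_trans[OF path_component_trans[OF pc(1,3)]]
          path_component_sym[OF path_component_trans[OF pc(2,4)]])
  qed
  then have "path_connected ?R"
    unfolding path_connected_component by auto
  then show ?thesis by (rule path_connected_imp_connected)
qed

section \<open>Sectional curvature as a continuous function of a pair at a fixed base point\<close>

definition section_curvature ::
    "real \<Rightarrow> real ^ 'p::finite ^ 'n::finite \<Rightarrow> real ^ 'p ^ 'n \<Rightarrow> real ^ 'p ^ 'n \<Rightarrow> real" where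
  "section_curvature \<alpha> q x y = stiefel_metric \<alpha> q (curvature_tensor \<alpha> q x y) x /
    (stiefel_metric \<alpha> q x x * stiefel_metric \<alpha> q y y - (stiefel_metric \<alpha> q x y)\<^sup>2)"

lemma subspace_tangent_space:
  fixes q :: "real ^ 'p::finite ^ 'n::finite"
  assumes "q \<in> Stiefel"
  shows "subspace (tangent_space Stiefel q)"
  unfolding subspace_def tangent_space_Stiefel[OF assms]
proof (intro conjI ballI allI)
  fix x y :: "real ^ 'p ^ 'n" and c :: real
  assume x: "x \<in> {v. transpose q ** v + transpose v ** q = 0}"
    and y: "y \<in> {v. transpose q ** v + transpose v ** q = 0}"
  have "transpose q ** (x + y) + transpose (x + y) ** q
      = (transpose q ** x + transpose x ** q) + (transpose q ** y + transpose y ** q)"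
    by (simp add: transpose_add mm.add_left mm.add_right)
  then show "x + y \<in> {v. transpose q ** v + transpose v ** q = 0}" using x y by simp
next
  fix x :: "real ^ 'p ^ 'n" and c :: real
  assume x: "x \<in> {v. transpose q ** v + transpose v ** q = 0}"
  have "transpose q ** (c *\<^sub>R x) + transpose (c *\<^sub>R x) ** q
      = c *\<^sub>R (transpose q ** x + transpose x ** q)"
    by (simp add: transpose_scaleR mm.scaleR_left mm.scaleR_right scaleR_add_right)
  then show "c *\<^sub>R x \<in> {v. transpose q ** v + transpose v ** q = 0}" using x by simp
qed (simp add: transpose_def vec_eq_iff matrix_matrix_mult_def)

text \<open>The fields demanded by the definition are the linear fields given by
  \<open>tangent_skew\<close>, which extend x and y.\<close>

lemma section_curvature_in_range:
  fixes q :: "real ^ 'p::finite ^ 'n::finite"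
  assumes q: "q \<in> Stiefel" and x: "x \<in> tangent_space Stiefel q" and y: "y \<in> tangent_space Stiefel q"
    and xy: "indep2 x y"
  shows "section_curvature \<alpha> q x y
    \<in> sectional_curvature_range (Stiefel :: (real ^ 'p ^ 'n) set) (stiefel_metric \<alpha>)"
proof -
  have q': "transpose q ** q = mat 1" using q by (simp add: Stiefel_iff)
  define a b where "a = tangent_skew q x" "b = tangent_skew q y"
  have a: "transpose a = - a" "a ** q = x" and b: "transpose b = - b" "b ** q = y"
    using x y tangent_skew[OF q'] q by (simp_all add: a_b_def tangent_space_Stiefel)
  have "span {x, y} \<subseteq> tangent_space Stiefel q"
    using x y subspace_tangent_space[OF q] by (simp add: span_minimal)
  moreover have "has_sectional_curvature Stiefel (stiefel_metric \<alpha>) q (span {x, y})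
      (section_curvature \<alpha> q x y)"
    unfolding has_sectional_curvature_def section_curvature_def
    using levi_civita_stiefel_connection[of \<alpha>] linear_field[OF a(1)] linear_field[OF b(1)]
      curvature_linear_fields[of \<alpha> a b q] a(2) b(2)
    by (intro exI[of _ "stiefel_connection \<alpha>"] exI[of _ "\<lambda>q. a ** q"] exI[of _ "\<lambda>q. b ** q"]) simp
  ultimately show ?thesis
    unfolding sectional_curvature_range_def using q dim_span_indep2[OF xy] subspace_span by blast
qed

lemma stiefel_metric_bilinear:
  "stiefel_metric \<alpha> q (x + y) z = stiefel_metric \<alpha> q x z + stiefel_metric \<alpha> q y z"
  "stiefel_metric \<alpha> q (c *\<^sub>R x) z = c * stiefel_metric \<alpha> q x z"
  "stiefel_metric \<alpha> q x z = stiefel_metric \<alpha> q z x"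
  "stiefel_metric \<alpha> q (x - y) z = stiefel_metric \<alpha> q x z - stiefel_metric \<alpha> q y z"
  for q :: "real ^ 'p::finite ^ 'n::finite"
  by (simp_all add: stiefel_metric_inner mm.add_right mm.scaleR_right mm.diff_right inner_add_left inner_diff_left
      inner_commute
      algebra_simps)

text \<open>Splitting x = q ** a + v with transpose q ** v = 0 diagonalises the metric to \<alpha>
  |a|^2 + |v|^2.\<close>

lemma stiefel_metric_pos:
  fixes q :: "real ^ 'p::finite ^ 'n::finite"
  assumes q: "q \<in> Stiefel" and "0 < \<alpha>" "x \<noteq> 0"
  shows "0 < stiefel_metric \<alpha> q x x"
proof -
  have q': "transpose q ** (q ** m) = m" for m :: "real ^ 'p ^ 'p"
    using q by (simp add: Stiefel_iff matrix_mul_assoc)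
  define a where "a = transpose q ** x"
  define v where "v = x - q ** a"
  have "transpose q ** v = 0" by (simp add: v_def mm.diff_right q' a_def)
  then have "inner (q ** a) v = 0" by (simp add: inner_mult_left)
  moreover have x: "x = q ** a + v" by (simp add: v_def)
  moreover have "inner (q ** a) (q ** a) = inner a a" by (simp add: inner_mult_left q')
  ultimately have "inner x x = inner a a + inner v v"
    by (simp add: inner_add_left inner_add_right inner_commute)
  then have e: "stiefel_metric \<alpha> q x x = \<alpha> * inner a a + inner v v"
    by (simp add: stiefel_metric_inner a_def algebra_simps)
  have "a \<noteq> 0 \<or> v \<noteq> 0" using x \<open>x \<noteq> 0\<close> by auto
  then show ?thesis
  proof (cases "v = 0")
    case True
    then show ?thesis using \<open>a \<noteq> 0 \<or> v \<noteq> 0\<close> \<open>0 < \<alpha>\<close> by (simp add: e)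
  next
    case False
    then show ?thesis unfolding e using \<open>0 < \<alpha>\<close> by (intro add_nonneg_pos) auto
  qed
qed

text \<open>Strict Cauchy-Schwarz: w = g(x,x) y - g(x,y) x is nonzero and orthogonal to x, and
  g(w,w) is g(x,x) times the Gram determinant. It keeps the denominator of
  \<open>section_curvature\<close> away from zero.\<close>

lemma gram_pos:
  fixes q :: "real ^ 'p::finite ^ 'n::finite"
  assumes q: "q \<in> Stiefel" and "0 < \<alpha>" "indep2 x y"
  shows "0 < stiefel_metric \<alpha> q x x * stiefel_metric \<alpha> q y y - (stiefel_metric \<alpha> q x y)\<^sup>2"
proof -
  let ?g = "stiefel_metric \<alpha> q"
  have gx: "0 < ?g x x"
    using stiefel_metric_pos[OF q \<open>0 < \<alpha>\<close>] indep2_nonzero[OF \<open>indep2 x y\<close>] by blast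
  define w where "w = (- ?g x y) *\<^sub>R x + ?g x x *\<^sub>R y"
  have "w \<noteq> 0"
    using \<open>indep2 x y\<close> gx unfolding w_def indep2_def by (metis less_irrefl)
  then have "0 < ?g w w"
    by (rule stiefel_metric_pos[OF q \<open>0 < \<alpha>\<close>])
  also have "?g w w = (- ?g x y) * ?g x w + ?g x x * ?g y w"
    unfolding w_def stiefel_metric_bilinear(1,2) ..
  also have "?g x w = 0"
    using stiefel_metric_bilinear(3)[of \<alpha> q x w] stiefel_metric_bilinear(3)[of \<alpha> q y x]
    by (simp add: w_def stiefel_metric_bilinear(1,2,4))
  also have "?g y w = - ?g x y * ?g x y + ?g x x * ?g y y"
    using stiefel_metric_bilinear(3)[of \<alpha> q y w]
    by (simp add: w_def stiefel_metric_bilinear(1,2,4))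
  finally have "0 < ?g x x * (?g x x * ?g y y - (?g x y)\<^sup>2)"
    by (simp add: power2_eq_square algebra_simps)
  then show ?thesis using gx by (simp add: zero_less_mult_iff)
qed

lemma continuous_on_matrix_mult:
  fixes f :: "'e::topological_space \<Rightarrow> real ^ 'b::finite ^ 'a::finite"
    and h :: "'e \<Rightarrow> real ^ 'c::finite ^ 'b"
  shows "continuous_on S f \<Longrightarrow> continuous_on S h \<Longrightarrow> continuous_on S (\<lambda>x. f x ** h x)"
  by (rule mm.continuous_on)

lemma continuous_on_transpose:
  fixes f :: "'e::topological_space \<Rightarrow> real ^ 'b::finite ^ 'a::finite"
  shows "continuous_on S f \<Longrightarrow> continuous_on S (\<lambda>x. transpose (f x))"
  by (rule bounded_linear.continuous_on[OF bounded_linear_transpose])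

lemma continuous_on_stiefel_metric:
  fixes q :: "real ^ 'p::finite ^ 'n::finite" and f h :: "'e::topological_space \<Rightarrow> real ^ 'p ^ 'n"
  assumes "continuous_on S f" "continuous_on S h"
  shows "continuous_on S (\<lambda>x. stiefel_metric \<alpha> q (f x) (h x))"
  unfolding stiefel_metric_inner
  by (intro continuous_on_add continuous_on_mult continuous_on_inner continuous_on_matrix_mult
      continuous_on_const assms)

lemma continuous_on_christoffel:
  fixes q :: "real ^ 'p::finite ^ 'n::finite" and f h :: "'e::topological_space \<Rightarrow> real ^ 'p ^ 'n"
  assumes "continuous_on S f" "continuous_on S h"
  shows "continuous_on S (\<lambda>x. christoffel \<alpha> q (f x) (h x))"
  unfolding christoffel_def
  by (intro continuous_on_add continuous_on_diff continuous_on_scaleR continuous_on_matrix_mult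
      continuous_on_transpose continuous_on_const assms)

lemma continuous_on_curvature_tensor:
  fixes q :: "real ^ 'p::finite ^ 'n::finite" and f h :: "'e::topological_space \<Rightarrow> real ^ 'p ^ 'n"
  assumes "continuous_on S f" "continuous_on S h"
  shows "continuous_on S (\<lambda>x. curvature_tensor \<alpha> q (f x) (h x))"
  unfolding curvature_tensor_def christoffel_deriv_def
  by (intro continuous_on_add continuous_on_diff continuous_on_scaleR continuous_on_matrix_mult
      continuous_on_transpose continuous_on_christoffel continuous_on_const assms)

lemma curvature_range_interval:
  fixes q :: "real ^ 'p::finite ^ 'n::finite"
  assumes q: "q \<in> Stiefel" and \<alpha>: "0 < \<alpha>" and dim: "5 \<le> dim (tangent_space Stiefel q)"
    and 1: "x \<in> tangent_space Stiefel q" "y \<in> tangent_space Stiefel q" "indep2 x y"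
    and 2: "x' \<in> tangent_space Stiefel q" "y' \<in> tangent_space Stiefel q" "indep2 x' y'"
  shows "{section_curvature \<alpha> q x y .. section_curvature \<alpha> q x' y'}
    \<subseteq> sectional_curvature_range (Stiefel :: (real ^ 'p ^ 'n) set) (stiefel_metric \<alpha>)"
proof -
  define R where "R = {(x, y). x \<in> tangent_space Stiefel q \<and> y \<in> tangent_space Stiefel q \<and> indep2 x y}"
  define K where "K = (\<lambda>z. section_curvature \<alpha> q (fst z) (snd z))"
  have "continuous_on R K"
    unfolding K_def section_curvature_def
  proof (rule continuous_on_divide)
    show "\<forall>z\<in>R. stiefel_metric \<alpha> q (fst z) (fst z) * stiefel_metric \<alpha> q (snd z) (snd z)
        - (stiefel_metric \<alpha> q (fst z) (snd z))\<^sup>2 \<noteq> 0"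
      using gram_pos[OF q \<alpha>] by (auto simp: R_def less_imp_neq[symmetric])
  qed (intro continuous_on_diff continuous_on_mult continuous_on_power continuous_on_fst
      continuous_on_snd continuous_on_id continuous_on_curvature_tensor continuous_on_stiefel_metric)+
  moreover have "connected R"
    unfolding R_def by (rule connected_indep2[OF subspace_tangent_space[OF q] dim])
  ultimately have "connected (K ` R)"
    by (rule connected_continuous_image)
  moreover have "K (x, y) \<in> K ` R" "K (x', y') \<in> K ` R"
    using 1 2 by (auto simp: R_def)
  ultimately have "{K (x, y) .. K (x', y')} \<subseteq> K ` R"
    using connected_contains_Icc by blast
  also have "\<dots> \<subseteq> sectional_curvature_range (Stiefel :: (real ^ 'p ^ 'n) set) (stiefel_metric \<alpha>)"
    using section_curvature_in_range[OF q] by (auto simp: R_def K_def)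
  finally show ?thesis by (simp add: K_def)
qed

section \<open>Sections spanned by matrix units\<close>

definition munit :: "'a \<Rightarrow> 'b \<Rightarrow> real ^ 'b::finite ^ 'a::finite" where
  "munit a b = (\<chi> r s. if r = a \<and> s = b then 1 else 0)"

lemma transpose_munit [simp]: "transpose (munit a b) = munit b a"
  by (auto simp: munit_def transpose_def vec_eq_iff)

lemma transpose_zero: "transpose (0 :: real ^ 'b::finite ^ 'a::finite) = 0"
  by (simp add: transpose_def vec_eq_iff)

lemma munit_mult: "munit a b ** munit c d = (if b = c then munit a d else 0)"
proof -
  have "(\<Sum>k\<in>UNIV. (if r = a \<and> k = b then 1 else 0) * (if k = c \<and> s = d then 1 else (0::real)))
      = (if b = c \<and> r = a \<and> s = d then 1 else 0)" for r s
  proof -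
    have "(\<Sum>k\<in>UNIV. (if r = a \<and> k = b then 1 else 0) * (if k = c \<and> s = d then 1 else (0::real)))
       = (\<Sum>k\<in>UNIV. if k = b then (if b = c \<and> r = a \<and> s = d then 1 else 0) else 0)"
      by (intro sum.cong) auto
    then show ?thesis by simp
  qed
  then show ?thesis
    by (auto simp: munit_def matrix_matrix_mult_def vec_eq_iff)
qed

lemma trace_munit: "trace (munit a b) = (if a = b then 1 else 0)"
  by (cases "a = b") (auto simp: trace_def munit_def intro!: sum.neutral)

lemma inner_munit: "inner (munit a b) (munit c d) = (if a = c \<and> b = d then 1 else 0)"
proof -
  have "inner (munit a b) (munit c d) = trace (munit b a ** munit c d)"
    by (simp flip: trace_transpose_mult)
  also have "\<dots> = (if a = c \<and> b = d then 1 else 0)"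
    by (auto simp: munit_mult trace_munit) (simp_all add: trace_def)
  finally show ?thesis .
qed

text \<open>On this type \<open>*\<close> is the componentwise product and a numeral is a constant
  matrix; as a scaling it becomes accessible to the bilinearity rules.\<close>

lemma numeral_mult_matrix: "numeral w * x = numeral w *\<^sub>R x" for x :: "real ^ 'b::finite ^ 'a::finite"
  by (simp add: vec_eq_iff)

text \<open>Finite index types carry no order, so an injection replaces the choice of the first p
  rows. Rows outside its range are the directions normal to the column space of
  \<open>base\<close>.\<close>

locale stiefel_basepoint =
  fixes \<iota> :: "'p::finite \<Rightarrow> 'n::finite"
  assumes inj: "inj \<iota>"
begin

definition base :: "real ^ 'p ^ 'n" where
  "base = (\<Sum>j\<in>UNIV. munit (\<iota> j) j)"

lemma iota_eq [simp]: "\<iota> i = \<iota> j \<longleftrightarrow> i = j"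
  using inj by (simp add: inj_eq)

lemma base_mult_munit: "base ** munit i b = munit (\<iota> i) b"
  by (simp add: base_def mm.sum_left munit_mult)

lemma transpose_base: "transpose base = (\<Sum>j\<in>UNIV. munit j (\<iota> j))"
  using linear_sum[of "transpose :: real ^ 'p ^ 'n \<Rightarrow> real ^ 'n ^ 'p" "\<lambda>j. munit (\<iota> j) j" UNIV]
    bounded_linear.linear[OF bounded_linear_transpose]
  by (simp add: base_def)

lemma base_mult_transpose_munit: "transpose base ** munit (\<iota> i) b = munit i b"
  "a \<notin> range \<iota> \<Longrightarrow> transpose base ** munit a b = 0"
  by (auto simp: transpose_base mm.sum_left munit_mult intro!: sum.neutral)

lemma munit_mult_base: "munit b (\<iota> i) ** base = munit b i"
  "a \<notin> range \<iota> \<Longrightarrow> munit b a ** base = 0"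
  by (auto simp: base_def mm.sum_right munit_mult intro!: sum.neutral)

lemma base_Stiefel: "base \<in> Stiefel"
proof -
  have "transpose base ** base = (\<Sum>j\<in>UNIV. munit j j)"
    by (subst (2) base_def) (simp add: mm.sum_right base_mult_transpose_munit)
  also have "\<dots> = mat 1"
    by (auto simp: vec_eq_iff mat_def munit_def sum_component intro!: sum.neutral)
  finally show ?thesis by (simp add: Stiefel_iff)
qed

text \<open>The tangent space at \<open>base\<close> is spanned by the \<open>rot i j\<close> and the \<open>munit e j\<close> with \<open>e \<notin> range \<iota>\<close>;
  the metric multiplies the squared Frobenius norm by \<open>\<alpha>\<close> on the former and by \<open>1\<close> on the latter.\<close>

definition rot :: "'p \<Rightarrow> 'p \<Rightarrow> real ^ 'p ^ 'n" where
  "rot i j = munit (\<iota> i) j - munit (\<iota> j) i"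

lemmas eval_simps = rot_def transpose_add transpose_diff transpose_minus transpose_scaleR
  mm.add_left mm.add_right mm.diff_left mm.diff_right mm.scaleR_left mm.scaleR_right mm.minus_left
  mm.minus_right munit_mult base_mult_munit base_mult_transpose_munit munit_mult_base
  inner_munit inner_add_left inner_add_right inner_diff_left inner_diff_right
  numeral_mult_matrix transpose_zero mm.zero_left mm.zero_right

lemma rot_tangent: "rot i j \<in> tangent_space Stiefel base"
  unfolding tangent_space_Stiefel[OF base_Stiefel] by (simp add: eval_simps)

lemma munit_tangent: "e \<notin> range \<iota> \<Longrightarrow> munit e j \<in> tangent_space Stiefel base"
  unfolding tangent_space_Stiefel[OF base_Stiefel] by (simp add: eval_simps)

text \<open>The two matrices share neither a row nor a column, so every product mixing them
  vanishes. This supplies the curvature value 0.\<close>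

lemma flat_section:
  assumes "distinct [i, j, k]" "e \<notin> range \<iota>"
  shows "stiefel_metric \<alpha> base (curvature_tensor \<alpha> base (munit e i) (rot j k)) (munit e i) = 0"
proof -
  have d: "i \<noteq> j" "j \<noteq> i" "i \<noteq> k" "k \<noteq> i" "j \<noteq> k" "k \<noteq> j" using assms(1) by auto
  have e: "e \<noteq> \<iota> m" "\<iota> m \<noteq> e" for m using assms(2) by auto
  show ?thesis
    unfolding curvature_tensor_def christoffel_def christoffel_deriv_def stiefel_metric_inner
    by (simp add: eval_simps d e assms(2))
qed

text \<open>Three columns and one normal row suffice, so the family is available for all n > p \<ge>
  3. The vectors are orthogonal for all parameters, which makes the Gram determinant a product; the
  sign of a b c d controls the mixed term and separates 1/(1 + 2 \<alpha>) from the values of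
  \<open>cfun\<close>.\<close>

lemma section_curvature_family:
  fixes a b c d \<alpha> :: real
  assumes "distinct [i, j, k]" "e \<notin> range \<iota>"
  defines "x \<equiv> a *\<^sub>R rot i j + b *\<^sub>R munit e k" and "y \<equiv> c *\<^sub>R rot i k + d *\<^sub>R munit e j"
  shows "stiefel_metric \<alpha> base x x = 2 * \<alpha> * a\<^sup>2 + b\<^sup>2"
    and "stiefel_metric \<alpha> base y y = 2 * \<alpha> * c\<^sup>2 + d\<^sup>2"
    and "stiefel_metric \<alpha> base x y = 0"
    and "stiefel_metric \<alpha> base (curvature_tensor \<alpha> base x y) x
      = \<alpha> / 2 * a\<^sup>2 * c\<^sup>2 + (2 - 3 * \<alpha>) / 2 * b\<^sup>2 * d\<^sup>2 + \<alpha>\<^sup>2 * (a\<^sup>2 * d\<^sup>2 + b\<^sup>2 * c\<^sup>2)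
        + (2 * \<alpha>\<^sup>2 - 3 * \<alpha>) * a * b * c * d"
proof -
  have d: "i \<noteq> j" "j \<noteq> i" "i \<noteq> k" "k \<noteq> i" "j \<noteq> k" "k \<noteq> j" using assms(1) by auto
  have e: "e \<noteq> \<iota> m" "\<iota> m \<noteq> e" for m using assms(2) by auto
  show "stiefel_metric \<alpha> base x x = 2 * \<alpha> * a\<^sup>2 + b\<^sup>2"
    "stiefel_metric \<alpha> base y y = 2 * \<alpha> * c\<^sup>2 + d\<^sup>2"
    "stiefel_metric \<alpha> base x y = 0"
    unfolding x_def y_def stiefel_metric_inner
    by (simp_all add: eval_simps d e assms(2)) (simp_all add: power2_eq_square algebra_simps)
  show "stiefel_metric \<alpha> base (curvature_tensor \<alpha> base x y) x
      = \<alpha> / 2 * a\<^sup>2 * c\<^sup>2 + (2 - 3 * \<alpha>) / 2 * b\<^sup>2 * d\<^sup>2 + \<alpha>\<^sup>2 * (a\<^sup>2 * d\<^sup>2 + b\<^sup>2 * c\<^sup>2)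
        + (2 * \<alpha>\<^sup>2 - 3 * \<alpha>) * a * b * c * d"
    unfolding x_def y_def curvature_tensor_def christoffel_def christoffel_deriv_def stiefel_metric_inner
    by (simp add: eval_simps d e assms(2)) (simp add: power2_eq_square field_simps)
qed

text \<open>A diagonal against an antidiagonal matrix in the block with rows e, f and columns i, j.
  Two normal rows exist only for n \<ge> p + 2.\<close>

lemma section_curvature_family_normal:
  fixes a b c d \<alpha> :: real
  assumes "i \<noteq> j" "e \<notin> range \<iota>" "f \<notin> range \<iota>" "e \<noteq> f"
  defines "x \<equiv> a *\<^sub>R munit e i + b *\<^sub>R munit f j" and "y \<equiv> c *\<^sub>R munit e j + d *\<^sub>R munit f i"
  shows "stiefel_metric \<alpha> base x x = a\<^sup>2 + b\<^sup>2"
    and "stiefel_metric \<alpha> base y y = c\<^sup>2 + d\<^sup>2"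
    and "stiefel_metric \<alpha> base x y = 0"
    and "stiefel_metric \<alpha> base (curvature_tensor \<alpha> base x y) x
      = (2 - 3 * \<alpha>) / 2 * (a\<^sup>2 * c\<^sup>2 + b\<^sup>2 * d\<^sup>2) + a\<^sup>2 * d\<^sup>2 + b\<^sup>2 * c\<^sup>2
        + (3 * \<alpha> - 4) * a * b * c * d"
proof -
  have d: "i \<noteq> j" "j \<noteq> i" "e \<noteq> f" "f \<noteq> e" using assms(1,4) by auto
  have e: "e \<noteq> \<iota> m" "\<iota> m \<noteq> e" "f \<noteq> \<iota> m" "\<iota> m \<noteq> f" for m using assms(2,3) by auto
  show "stiefel_metric \<alpha> base x x = a\<^sup>2 + b\<^sup>2"
    "stiefel_metric \<alpha> base y y = c\<^sup>2 + d\<^sup>2"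
    "stiefel_metric \<alpha> base x y = 0"
    unfolding x_def y_def stiefel_metric_inner
    by (simp_all add: eval_simps d e assms(2,3)) (simp_all add: power2_eq_square algebra_simps)
  show "stiefel_metric \<alpha> base (curvature_tensor \<alpha> base x y) x
      = (2 - 3 * \<alpha>) / 2 * (a\<^sup>2 * c\<^sup>2 + b\<^sup>2 * d\<^sup>2) + a\<^sup>2 * d\<^sup>2 + b\<^sup>2 * c\<^sup>2
        + (3 * \<alpha> - 4) * a * b * c * d"
    unfolding x_def y_def curvature_tensor_def christoffel_def christoffel_deriv_def stiefel_metric_inner
    by (simp add: eval_simps d e assms(2,3)) (simp add: power2_eq_square field_simps)
qed

text \<open>Both matrices lie in one of the two commuting copies of so(3) in the so(4) of the four
  indices, where the commutator is large: the quotient 1/(4 \<alpha>) is twice that of two rotations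
  sharing one index.\<close>

lemma section_curvature_rotations:
  fixes \<alpha> :: real
  assumes "distinct [i, j, k, l]"
  defines "x \<equiv> rot i j + rot k l" and "y \<equiv> rot i k - rot j l"
  shows "stiefel_metric \<alpha> base x x = 4 * \<alpha>"
    and "stiefel_metric \<alpha> base y y = 4 * \<alpha>"
    and "stiefel_metric \<alpha> base x y = 0"
    and "stiefel_metric \<alpha> base (curvature_tensor \<alpha> base x y) x = 4 * \<alpha>"
proof -
  have d: "i \<noteq> j" "j \<noteq> i" "i \<noteq> k" "k \<noteq> i" "j \<noteq> k" "k \<noteq> j" "i \<noteq> l" "l \<noteq> i" "j \<noteq> l" "l \<noteq> j"
    "k \<noteq> l" "l \<noteq> k"
    using assms(1) by auto
  show "stiefel_metric \<alpha> base x x = 4 * \<alpha>"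
    "stiefel_metric \<alpha> base y y = 4 * \<alpha>"
    "stiefel_metric \<alpha> base x y = 0"
    unfolding x_def y_def stiefel_metric_inner
    by (simp_all add: eval_simps d)
  show "stiefel_metric \<alpha> base (curvature_tensor \<alpha> base x y) x = 4 * \<alpha>"
    unfolding x_def y_def curvature_tensor_def christoffel_def christoffel_deriv_def stiefel_metric_inner
    by (simp add: eval_simps d)
qed

lemma dim_tangent_space_ge:
  fixes i j k :: 'p and e :: 'n
  assumes "distinct [i, j, k]" "e \<notin> range \<iota>"
  shows "5 \<le> dim (tangent_space Stiefel base)"
proof -
  have d: "i \<noteq> j" "j \<noteq> i" "i \<noteq> k" "k \<noteq> i" "j \<noteq> k" "k \<noteq> j" using assms(1) by auto
  have e: "e \<noteq> \<iota> m" "\<iota> m \<noteq> e" for m using assms(2) by auto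
  define vs where "vs = [rot i j, rot i k, munit e i, munit e j, munit e k]"
  have orth: "inner (vs ! m) (vs ! n) = (if m = n then inner (vs ! m) (vs ! m) else 0)"
    and pos: "inner (vs ! m) (vs ! m) > 0" if "m < 5" "n < 5" for m n
  proof -
    have m: "m \<in> {0, 1, 2, 3, 4}" "n \<in> {0, 1, 2, 3, 4}" using that by auto
    show "inner (vs ! m) (vs ! n) = (if m = n then inner (vs ! m) (vs ! m) else 0)"
      using m by (auto simp: vs_def eval_simps d e nth_Cons')
    show "inner (vs ! m) (vs ! m) > 0"
      using m by (auto simp: vs_def eval_simps d e nth_Cons' simp del: inner_gt_zero_iff)
  qed
  have len: "length vs = 5" by (simp add: vs_def)
  have "distinct vs"
    unfolding distinct_conv_nth len using orth pos by (metis less_irrefl)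
  then have "card (set vs) = 5" by (simp add: distinct_card len)
  moreover have "independent (set vs)"
  proof (rule pairwise_orthogonal_independent)
    show "pairwise orthogonal (set vs)"
    proof (rule pairwiseI)
      fix v w assume "v \<in> set vs" "w \<in> set vs" "v \<noteq> w"
      then obtain m n where "m < 5" "n < 5" "v = vs ! m" "w = vs ! n" "m \<noteq> n"
        unfolding in_set_conv_nth len by blast
      then show "orthogonal v w" using orth[of m n] by (simp add: orthogonal_def)
    qed
    show "0 \<notin> set vs"
      unfolding in_set_conv_nth len using pos by (metis inner_zero_left less_irrefl)
  qed
  moreover have "set vs \<subseteq> tangent_space Stiefel base"
    using rot_tangent munit_tangent[OF assms(2)] by (simp add: vs_def)
  ultimately show ?thesis
    using independent_card_le_dim by metis
qed


section \<open>Attained curvatures\<close>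

text \<open>Tied to the single point \<open>base\<close>, since two values can be joined only
  through pairs in one tangent space.\<close>

definition attained :: "real \<Rightarrow> real \<Rightarrow> bool" where
  "attained \<alpha> \<kappa> \<longleftrightarrow> (\<exists>x y. x \<in> tangent_space Stiefel base \<and> y \<in> tangent_space Stiefel base \<and>
     indep2 x y \<and> section_curvature \<alpha> base x y = \<kappa>)"

lemma attained_interval:
  fixes i j k :: 'p and e :: 'n
  assumes "0 < \<alpha>" "distinct [i, j, k]" "e \<notin> range \<iota>" "attained \<alpha> \<kappa>" "attained \<alpha> \<kappa>'"
  shows "{\<kappa> .. \<kappa>'} \<subseteq> sectional_curvature_range (Stiefel :: (real ^ 'p ^ 'n) set) (stiefel_metric \<alpha>)"
  using assms(4,5) curvature_range_interval[OF base_Stiefel assms(1) dim_tangent_space_ge[OF assms(2,3)]]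
  unfolding attained_def by blast

text \<open>Orthogonality and positive squared lengths give independence and reduce the Gram
  determinant to A * B.\<close>

lemma attainedI:
  assumes "x \<in> tangent_space Stiefel base" "y \<in> tangent_space Stiefel base"
    and "stiefel_metric \<alpha> base x x = A" "stiefel_metric \<alpha> base y y = B"
    and xy: "stiefel_metric \<alpha> base x y = 0"
    and "stiefel_metric \<alpha> base (curvature_tensor \<alpha> base x y) x = C"
    and "0 < A" "0 < B" "C / (A * B) = \<kappa>"
  shows "attained \<alpha> \<kappa>"
proof -
  have "indep2 x y"
    unfolding indep2_def
  proof (intro allI impI)
    fix r s assume 0: "r *\<^sub>R x + s *\<^sub>R y = 0"
    have z: "stiefel_metric \<alpha> base 0 w = 0" for w
      by (simp add: stiefel_metric_inner mm.zero_right)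
    have r: "stiefel_metric \<alpha> base (r *\<^sub>R x + s *\<^sub>R y) x = r * A"
      using assms(3) xy stiefel_metric_bilinear(3)[of \<alpha> base y x]
      by (simp add: stiefel_metric_bilinear(1,2))
    have s: "stiefel_metric \<alpha> base (r *\<^sub>R x + s *\<^sub>R y) y = s * B"
      using assms(4) xy by (simp add: stiefel_metric_bilinear(1,2))
    show "r = 0 \<and> s = 0"
      using r[unfolded 0 z] s[unfolded 0 z] assms(7,8) by simp
  qed
  then show ?thesis
    unfolding attained_def section_curvature_def using assms by (intro exI[of _ x] exI[of _ y]) simp
qed

lemma attained_family:
  fixes i j k :: 'p and e :: 'n and a b c d :: real
  assumes "distinct [i, j, k]" "e \<notin> range \<iota>" "0 < 2 * \<alpha> * a\<^sup>2 + b\<^sup>2" "0 < 2 * \<alpha> * c\<^sup>2 + d\<^sup>2"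
    and "(\<alpha> / 2 * a\<^sup>2 * c\<^sup>2 + (2 - 3 * \<alpha>) / 2 * b\<^sup>2 * d\<^sup>2 + \<alpha>\<^sup>2 * (a\<^sup>2 * d\<^sup>2 + b\<^sup>2 * c\<^sup>2)
        + (2 * \<alpha>\<^sup>2 - 3 * \<alpha>) * a * b * c * d)
      / ((2 * \<alpha> * a\<^sup>2 + b\<^sup>2) * (2 * \<alpha> * c\<^sup>2 + d\<^sup>2)) = \<kappa>"
  shows "attained \<alpha> \<kappa>"
  by (rule attainedI[OF _ _ section_curvature_family[OF assms(1,2)] assms(3,4,5)])
    (intro subspace_add subspace_scale subspace_tangent_space base_Stiefel rot_tangent
      munit_tangent assms(2))+

lemma attained_family_normal:
  fixes i j :: 'p and e f :: 'n and a b c d :: real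
  assumes "i \<noteq> j" "e \<notin> range \<iota>" "f \<notin> range \<iota>" "e \<noteq> f" "0 < a\<^sup>2 + b\<^sup>2" "0 < c\<^sup>2 + d\<^sup>2"
    and "((2 - 3 * \<alpha>) / 2 * (a\<^sup>2 * c\<^sup>2 + b\<^sup>2 * d\<^sup>2) + a\<^sup>2 * d\<^sup>2 + b\<^sup>2 * c\<^sup>2
        + (3 * \<alpha> - 4) * a * b * c * d) / ((a\<^sup>2 + b\<^sup>2) * (c\<^sup>2 + d\<^sup>2)) = \<kappa>"
  shows "attained \<alpha> \<kappa>"
  by (rule attainedI[OF _ _ section_curvature_family_normal[OF assms(1-4)] assms(5-7)])
    (intro subspace_add subspace_scale subspace_tangent_space base_Stiefel munit_tangent assms(2,3))+

lemma attained_values: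
  fixes i j k :: 'p and e :: 'n
  assumes "0 < \<alpha>" "distinct [i, j, k]" "e \<notin> range \<iota>"
  shows "attained \<alpha> 0" and "attained \<alpha> (1 / (8 * \<alpha>))" and "attained \<alpha> (\<alpha> / 2)"
    and "attained \<alpha> ((2 - 3 * \<alpha>) / 2)" and "attained \<alpha> (1 / (1 + 2 * \<alpha>))"
    and "0 \<le> \<gamma> \<Longrightarrow> attained \<alpha> (cfun \<alpha> \<gamma>)"
proof -
  note fam = attained_family[OF assms(2,3)]
  have e: "e \<noteq> \<iota> m" "\<iota> m \<noteq> e" for m using assms(3) by auto
  have d: "j \<noteq> k" "k \<noteq> j" "i \<noteq> j" "j \<noteq> i" "i \<noteq> k" "k \<noteq> i" using assms(2) by auto
  have m: "stiefel_metric \<alpha> base (munit e i) (munit e i) = 1"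
    "stiefel_metric \<alpha> base (rot j k) (rot j k) = 2 * \<alpha>"
    "stiefel_metric \<alpha> base (munit e i) (rot j k) = 0"
    unfolding stiefel_metric_inner by (simp_all add: eval_simps d e assms(3))
  show "attained \<alpha> 0"
    by (rule attainedI[OF munit_tangent[OF assms(3)] rot_tangent m flat_section[OF assms(2,3)]])
      (use assms(1) in auto)
  \<comment> \<open>The parameters are a, b, c, d of the family. The next three values come from two
    rotations sharing i, from a normal unit and a rotation sharing column k, and from two normal
    units in row e.\<close>
  show "attained \<alpha> (1 / (8 * \<alpha>))"
    by (rule fam[of \<alpha> 1 0 1 0]) (use assms(1) in \<open>auto simp: field_simps\<close>)
  show "attained \<alpha> (\<alpha> / 2)"
    by (rule fam[of \<alpha> 0 1 1 0]) (use assms(1) in \<open>auto simp: field_simps power2_eq_square\<close>)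
  show "attained \<alpha> ((2 - 3 * \<alpha>) / 2)"
    by (rule fam[of \<alpha> 0 1 0 1]) (use assms(1) in \<open>auto simp: field_simps\<close>)
  show "attained \<alpha> (1 / (1 + 2 * \<alpha>))"
  \<comment> \<open>The negative sign reverses the mixed term; the numerator collapses to 1 + 2
    \<alpha>, which is one of the two equal factors of the denominator.\<close>
  proof (rule fam[of \<alpha> 1 1 1 "-1"])
    have "\<alpha> / 2 * 1\<^sup>2 * 1\<^sup>2 + (2 - 3 * \<alpha>) / 2 * 1\<^sup>2 * (- 1)\<^sup>2 + \<alpha>\<^sup>2 * (1\<^sup>2 * (- 1)\<^sup>2 + 1\<^sup>2 * 1\<^sup>2)
        + (2 * \<alpha>\<^sup>2 - 3 * \<alpha>) * 1 * 1 * 1 * (- 1) = 1 + 2 * \<alpha>"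
      by (simp add: field_simps)
    then show "(\<alpha> / 2 * 1\<^sup>2 * 1\<^sup>2 + (2 - 3 * \<alpha>) / 2 * 1\<^sup>2 * (- 1)\<^sup>2 + \<alpha>\<^sup>2 * (1\<^sup>2 * (- 1)\<^sup>2 + 1\<^sup>2 * 1\<^sup>2)
        + (2 * \<alpha>\<^sup>2 - 3 * \<alpha>) * 1 * 1 * 1 * (- 1)) / ((2 * \<alpha> * 1\<^sup>2 + 1\<^sup>2) * (2 * \<alpha> * 1\<^sup>2 + (- 1)\<^sup>2))
        = 1 / (1 + 2 * \<alpha>)"
      using assms(1) by (simp add: add.commute)
  qed (use assms(1) in auto)
  assume "0 \<le> \<gamma>"
  then have ss: "sqrt \<gamma> * (sqrt \<gamma> * r) = \<gamma> * r" for r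
    by (simp flip: mult.assoc)
  \<comment> \<open>Here a = c = 1 and b = d, so \<gamma> is the common square of b and d.\<close>
  show "attained \<alpha> (cfun \<alpha> \<gamma>)"
    using \<open>0 \<le> \<gamma>\<close> by (intro fam[of \<alpha> 1 "sqrt \<gamma>" 1 "sqrt \<gamma>"])
      (use assms(1) in \<open>auto simp: cfun_def add_pos_nonneg power2_eq_square[of "2 * \<alpha> + \<gamma>"]
          algebra_simps ss power2_eq_square\<close>)
qed

lemma attained_values_normal:
  fixes i j :: 'p and e f :: 'n
  assumes "i \<noteq> j" "e \<notin> range \<iota>" "f \<notin> range \<iota>" "e \<noteq> f"
  shows "attained \<alpha> 1" and "attained \<alpha> ((4 - 3 * \<alpha>) / 2)"
proof -
  note fam = attained_family_normal[OF assms]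
  show "attained \<alpha> 1" by (rule fam[of 1 0 0 1]) auto
  show "attained \<alpha> ((4 - 3 * \<alpha>) / 2)" by (rule fam[of 1 1 1 "-1"]) (auto simp: field_simps)
qed

lemma attained_rotations:
  fixes i j k l :: 'p
  assumes "0 < \<alpha>" "distinct [i, j, k, l]"
  shows "attained \<alpha> (1 / (4 * \<alpha>))"
  by (rule attainedI[OF _ _ section_curvature_rotations[OF assms(2)]])
    (use assms(1) in \<open>auto intro!: subspace_add subspace_diff subspace_tangent_space base_Stiefel rot_tangent\<close>)

text \<open>\<open>gamma_min \<alpha>\<close> is the critical point of \<open>cfun \<alpha>\<close>:
  the derivative is a positive multiple of (7 - 10 \<alpha>) \<gamma> - (1 + 6 \<alpha> - 8
  \<alpha>^2). To serve as a square of a parameter it has to be nonnegative.\<close>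

lemma attained_lfun:
  fixes i j k :: 'p and e :: 'n
  assumes "1 / 2 < \<alpha>" "\<alpha> \<le> 7 / 10" "distinct [i, j, k]" "e \<notin> range \<iota>"
  shows "attained \<alpha> (lfun \<alpha>)"
proof (cases "\<alpha> = 7 / 10")
  case True
  \<comment> \<open>The value -1/20 is the limit of \<open>cfun\<close> as \<gamma> grows, realised
    by the limiting section with a = c = 0.\<close>
  then have "lfun \<alpha> = (2 - 3 * \<alpha>) / 2" by (simp add: lfun_def)
  moreover have "attained \<alpha> ((2 - 3 * \<alpha>) / 2)"
    using assms(1) by (intro attained_values(4)[OF _ assms(3,4)]) simp
  ultimately show ?thesis by (simp only:)
next
  case False
  \<comment> \<open>The numerator of \<open>gamma_min\<close> is 1 + 2 \<alpha> (3 - 4 \<alpha>),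
    and \<alpha> \<le> 7/10 < 3/4.\<close>
  have "0 \<le> 2 * \<alpha> * (3 - 4 * \<alpha>)" using assms(1,2) by (intro mult_nonneg_nonneg) auto
  then have "0 \<le> 1 + 6 * \<alpha> - 8 * \<alpha>\<^sup>2"
    by (simp add: power2_eq_square algebra_simps)
  then have "0 \<le> gamma_min \<alpha>"
    unfolding gamma_min_def using assms(2) by (intro divide_nonneg_nonneg) auto
  then show ?thesis
    using attained_values(6)[OF _ assms(3,4)] assms False by (simp add: lfun_def)
qed

end

theorem proposition2:
  fixes \<alpha> :: real
  assumes "3 \<le> CARD('p::finite)" and "CARD('p) < CARD('n::finite)" and "0 < \<alpha>"
  shows "curvature_interval CARD('n) CARD('p) \<alpha>
    \<subseteq> sectional_curvature_range (Stiefel :: (real ^ 'p ^ 'n) set) (stiefel_metric \<alpha>)"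
proof -
  obtain \<iota> :: "'p \<Rightarrow> 'n" where "inj \<iota>"
    using card_le_inj[of "UNIV :: 'p set" "UNIV :: 'n set"] assms(2) by auto
  interpret stiefel_basepoint \<iota> by standard fact
  let ?R = "sectional_curvature_range (Stiefel :: (real ^ 'p ^ 'n) set) (stiefel_metric \<alpha>)"
  obtain \<phi> where "bij_betw \<phi> {0..<CARD('p)} (UNIV :: 'p set)"
    using ex_bij_betw_nat_finite[of "UNIV :: 'p set"] by auto
  then have \<phi>: "\<phi> a = \<phi> b \<longleftrightarrow> a = b" if "a < CARD('p)" "b < CARD('p)" for a b
    using that by (auto simp: bij_betw_def inj_on_def)
  have ijk: "distinct [\<phi> 0, \<phi> 1, \<phi> 2]"
    using assms(1) by (simp add: \<phi>)
  have card: "card (UNIV - range \<iota>) = CARD('n) - CARD('p)"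
    by (simp add: card_Diff_subset card_image[OF \<open>inj \<iota>\<close>])
  then have "card (UNIV - range \<iota>) > 0" using assms(2) by simp
  then obtain e where e: "e \<notin> range \<iota>" by (auto simp: card_gt_0_iff)
  note interval = attained_interval[OF assms(3) ijk e]
  note vals = attained_values[OF assms(3) ijk e]
  have four: "attained \<alpha> (1 / (4 * \<alpha>))" if "CARD('p) \<noteq> 3"
    using attained_rotations[of \<alpha> "\<phi> 0" "\<phi> 1" "\<phi> 2" "\<phi> 3"] that assms(1,3) by (simp add: \<phi>)
  have normal: "attained \<alpha> 1" "attained \<alpha> ((4 - 3 * \<alpha>) / 2)" if "CARD('p) + 2 \<le> CARD('n)"
  proof -
    have "card (UNIV - range \<iota> - {e}) > 0"
      using card that e by (subst card_Diff_singleton) auto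
    then obtain f where "f \<notin> range \<iota>" "e \<noteq> f" by (auto simp: card_gt_0_iff)
    then show "attained \<alpha> 1" "attained \<alpha> ((4 - 3 * \<alpha>) / 2)"
      using attained_values_normal[of "\<phi> 0" "\<phi> 1" e f] e ijk by auto
  qed
  have lower: "attained \<alpha> (lfun \<alpha>)" if "\<not> \<alpha> \<le> 1 / 2" "\<alpha> \<le> 7 / 10"
    using attained_lfun[OF _ _ ijk e] that by simp
  \<comment> \<open>The branch p = 3 excludes (4, 3) but does not mention n \<ge> 5; the two normal
    rows required by \<open>normal\<close> are recovered from that exclusion.\<close>
  have codim: "CARD('p) + 2 \<le> CARD('n)" if "\<not> (CARD('n) = 4 \<and> CARD('p) = 3)" "CARD('p) = 3"
    using that assms(2) by linarith
  show ?thesis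
    unfolding curvature_interval_def
    using codim by (simp add: interval vals normal four lower)
qed

end
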